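(* Let $c_1,c_2$ be free circular random variables, and let $f=\sum_{i,j=1}^2a_{ij}c_ic_j+\sum_{i=1}^2b_ic_i$ with $A=(a_{ij})\in M_2(\mathbb{C})$ and $b={}^t\!\begin{pmatrix}b_1&b_2\end{pmatrix}\in\mathbb{C}^2$. Then the spectral set of $f$ is the set of $\lambda\in\mathbb{C}$ such that either $\lambda=0$, or $\lambda\neq0$ and $$\lim_{n\to\infty}Q_\lambda^ne_1\neq0$$ (that is, $Q_\lambda^ne_1$ does not converge to $0$ as $n\to\infty$), where $e_1={}^t\!\begin{pmatrix}1&0&0&0&0&0\end{pmatrix}$ and $Q_\lambda$ is the $6\times6$ matrix, written in blocks of sizes $1,1,2,2$, $$Q_\lambda=\begin{pmatrix} {b_\lambda^*} b_\lambda & \mathrm{Tr}(|A_\lambda|^2) & b_\lambda^* A_\lambda & {}^t\! b_\lambda \overline{A_\lambda} \\ 1 & 0 & 0 & 0 \\ \overline{b_\lambda} & 0 & 0 & \overline{A_\lambda} \\ {b_\lambda} & 0 & A_\lambda & 0 \end{pmatrix}$$ with $A_\lambda=\lambda^{-1}A$ and $b_\lambda=\lambda^{-1}b$.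
   Context: Free circular random variables $c_1,c_2$ are given by $c_i=\frac{s_i+\sqrt{-1}\,s_{2+i}}{\sqrt2}$, where $s_1,\ldots,s_4$ is a standard free semicircular system: $s_j=l(e_j)+l^*(e_j)$ on the full Fock space $\mathcal{F}(\mathbb{C}^4)=\mathbb{C}\Omega\oplus\bigoplus_{n\ge1}(\mathbb{C}^4)^{\otimes n}$, with $\{e_j\}$ an orthonormal basis of $\mathbb{C}^4$, $l(\xi)$ the left creation operator and $l^*(\xi)$ its adjoint. The spectral set of a bounded operator $X$ is the set of $\lambda\in\mathbb{C}$ such that $(\lambda-X)^{-1}$ does not exist as a bounded operator. Notation: ${}^t\! b$ is the transpose, $\overline{\,\cdot\,}$ is entrywise complex conjugation, $^*$ is conjugate transpose, $|A|^2=A^*A$, and $\mathrm{Tr}$ is the unnormalized trace. *)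

theory Defs
  imports "HOL-Analysis.Analysis"
begin

section \<open>The complex Hilbert space of square-summable families\<close>

typedef 'a ell2 = "{x :: 'a \<Rightarrow> complex. (\<lambda>i. (cmod (x i))\<^sup>2) summable_on UNIV}"
  morphisms coord Abs_ell2
  by (rule exI[of _ "\<lambda>_. 0"]) simp

setup_lifting type_definition_ell2

lemma coord_summable: "(\<lambda>i. (cmod (coord x i))\<^sup>2) summable_on UNIV"
  using coord[of x] by simp

lemma ell2_mult_abs_summable:
  fixes x y :: "'a \<Rightarrow> complex"
  assumes "(\<lambda>i. (cmod (x i))\<^sup>2) summable_on UNIV" "(\<lambda>i. (cmod (y i))\<^sup>2) summable_on UNIV"
  shows "(\<lambda>i. cmod (x i) * cmod (y i)) summable_on UNIV"
proof (rule summable_on_comparison_test)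
  show "(\<lambda>i. (cmod (x i))\<^sup>2 + (cmod (y i))\<^sup>2) summable_on UNIV"
    using assms by (rule summable_on_add)
  show "cmod (x i) * cmod (y i) \<le> (cmod (x i))\<^sup>2 + (cmod (y i))\<^sup>2" for i
  proof -
    have "0 \<le> (cmod (x i) - cmod (y i))\<^sup>2" "0 \<le> cmod (x i) * cmod (y i)" by simp_all
    then show ?thesis unfolding power2_diff by linarith
  qed
qed simp

lemma ell2_add_summable:
  fixes x y :: "'a \<Rightarrow> complex"
  assumes "(\<lambda>i. (cmod (x i))\<^sup>2) summable_on UNIV" "(\<lambda>i. (cmod (y i))\<^sup>2) summable_on UNIV"
  shows "(\<lambda>i. (cmod (x i + y i))\<^sup>2) summable_on UNIV"
proof (rule summable_on_comparison_test)
  show "(\<lambda>i. (cmod (x i))\<^sup>2 + (cmod (y i))\<^sup>2 + 2 * (cmod (x i) * cmod (y i))) summable_on UNIV"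
    by (intro summable_on_add assms summable_on_cmult_right ell2_mult_abs_summable)
  show "(cmod (x i + y i))\<^sup>2 \<le> (cmod (x i))\<^sup>2 + (cmod (y i))\<^sup>2 + 2 * (cmod (x i) * cmod (y i))" for i
    using power_mono[OF norm_triangle_ineq[of "x i" "y i"], of 2] by (simp add: power2_sum)
qed simp

lemma ell2_cmult_summable:
  fixes x :: "'a \<Rightarrow> complex"
  assumes "(\<lambda>i. (cmod (x i))\<^sup>2) summable_on UNIV"
  shows "(\<lambda>i. (cmod (a * x i))\<^sup>2) summable_on UNIV"
  using summable_on_cmult_right[OF assms, of "(cmod a)\<^sup>2"]
  by (simp add: norm_mult power_mult_distrib)

lift_definition scaleC :: "complex \<Rightarrow> 'a ell2 \<Rightarrow> 'a ell2"  (infixr "*\<^sub>C" 75)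
  is "\<lambda>a x i. a * x i"
  by (rule ell2_cmult_summable)

text \<open>The inner product is conjugate-linear in its first argument.\<close>

definition cinner :: "'a ell2 \<Rightarrow> 'a ell2 \<Rightarrow> complex" where
  "cinner x y = (\<Sum>\<^sub>\<infinity>i. cnj (coord x i) * coord y i)"

lemma cinner_summable: "(\<lambda>i. cnj (coord x i) * coord y i) summable_on UNIV"
proof (rule abs_summable_summable)
  show "(\<lambda>i. cmod (cnj (coord x i) * coord y i)) summable_on UNIV"
    using ell2_mult_abs_summable[OF coord_summable coord_summable, of x y]
    by (simp add: norm_mult)
qed

text \<open>The type class instance uses the real inner product \<open>Re \<langle>x, y\<rangle>\<close>, whose norm is the usual
  Hilbert space norm.\<close>

instantiation ell2 :: (type) real_inner
begin

lift_definition zero_ell2 :: "'a ell2" is "\<lambda>_. 0" by simp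
lift_definition plus_ell2 :: "'a ell2 \<Rightarrow> 'a ell2 \<Rightarrow> 'a ell2" is "\<lambda>x y i. x i + y i"
  by (rule ell2_add_summable)
lift_definition uminus_ell2 :: "'a ell2 \<Rightarrow> 'a ell2" is "\<lambda>x i. - x i" by simp
definition minus_ell2 :: "'a ell2 \<Rightarrow> 'a ell2 \<Rightarrow> 'a ell2" where "x - y = x + - (y :: 'a ell2)"
definition scaleR_ell2 :: "real \<Rightarrow> 'a ell2 \<Rightarrow> 'a ell2" where "r *\<^sub>R (x :: 'a ell2) = complex_of_real r *\<^sub>C x"
definition inner_ell2 :: "'a ell2 \<Rightarrow> 'a ell2 \<Rightarrow> real" where "inner x y = Re (cinner x y)"
definition norm_ell2 :: "'a ell2 \<Rightarrow> real" where "norm x = sqrt (\<Sum>\<^sub>\<infinity>i. (cmod (coord x i))\<^sup>2)"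
definition sgn_ell2 :: "'a ell2 \<Rightarrow> 'a ell2" where "sgn x = inverse (norm x) *\<^sub>R (x :: 'a ell2)"
definition dist_ell2 :: "'a ell2 \<Rightarrow> 'a ell2 \<Rightarrow> real" where "dist x y = norm (x - y :: 'a ell2)"
definition uniformity_ell2 :: "('a ell2 \<times> 'a ell2) filter" where
  "uniformity_ell2 = (INF e\<in>{0<..}. principal {(x, y). dist x y < e})"
definition open_ell2 :: "'a ell2 set \<Rightarrow> bool" where
  "open_ell2 U = (\<forall>x\<in>U. eventually (\<lambda>(x', y). x' = x \<longrightarrow> y \<in> U) uniformity)"

lemma coord_simps:
  "coord (0 :: 'a ell2) i = 0" "coord (x + y) i = coord x i + coord y i"
  "coord (- x) i = - coord x i" "coord (x - y) i = coord x i - coord y i"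
  "coord (a *\<^sub>C x) i = a * coord x i" "coord (r *\<^sub>R x) i = complex_of_real r * coord x i"
  for x y :: "'a ell2"
  by (simp_all add: zero_ell2.rep_eq plus_ell2.rep_eq uminus_ell2.rep_eq minus_ell2_def
      scaleC.rep_eq scaleR_ell2_def)

lemma ell2_eqI: "(\<And>i. coord x i = coord y i) \<Longrightarrow> x = y" for x y :: "'a ell2"
  by (simp add: coord_inject[symmetric] fun_eq_iff)

lemma cinner_commute: "cinner x y = cnj (cinner y x)" for x y :: "'a ell2"
  unfolding cinner_def infsum_cnj[symmetric] by (simp add: mult.commute)

lemma cinner_add_left: "cinner (x + y) z = cinner x z + cinner y z" for x y z :: "'a ell2"
  unfolding cinner_def infsum_add[OF cinner_summable cinner_summable, symmetric]
  by (simp add: coord_simps distrib_right)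

lemma cinner_scaleC_left: "cinner (a *\<^sub>C x) y = cnj a * cinner x y" for x y :: "'a ell2"
  unfolding cinner_def infsum_cmult_right'[symmetric] by (simp add: coord_simps mult.assoc)

lemma cinner_self:
  "cinner x x = complex_of_real (\<Sum>\<^sub>\<infinity>i. (cmod (coord x i))\<^sup>2)" for x :: "'a ell2"
proof -
  have "((\<lambda>i. complex_of_real ((cmod (coord x i))\<^sup>2)) has_sum
      complex_of_real (\<Sum>\<^sub>\<infinity>i. (cmod (coord x i))\<^sup>2)) UNIV"
    by (intro has_sum_of_real has_sum_infsum coord_summable)
  moreover have "cnj (coord x i) * coord x i = complex_of_real ((cmod (coord x i))\<^sup>2)" for i
    using complex_norm_square[of "coord x i"] by (simp only: mult.commute)
  ultimately show ?thesis unfolding cinner_def by (simp only: infsumI)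
qed

instance
proof
  fix x y z :: "'a ell2" and r s :: real and U :: "'a ell2 set"
  show "x + y + z = x + (y + z)" "x + y = y + x" "0 + x = x" "- x + x = 0" "x - y = x + - y"
    "r *\<^sub>R (x + y) = r *\<^sub>R x + r *\<^sub>R y" "(r + s) *\<^sub>R x = r *\<^sub>R x + s *\<^sub>R x"
    "r *\<^sub>R s *\<^sub>R x = (r * s) *\<^sub>R x" "1 *\<^sub>R x = x"
    by (rule ell2_eqI; simp add: coord_simps algebra_simps)+
  show "sgn x = inverse (norm x) *\<^sub>R x" by (simp add: sgn_ell2_def)
  show "dist x y = norm (x - y)" by (simp add: dist_ell2_def)
  show "uniformity = (INF e\<in>{0<..}. principal {(x, y). dist x (y :: 'a ell2) < e})"
    by (simp add: uniformity_ell2_def)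
  show "open U = (\<forall>x\<in>U. \<forall>\<^sub>F (x', y) in uniformity. x' = x \<longrightarrow> y \<in> U)"
    by (simp add: open_ell2_def)
  show "inner x y = inner y x" unfolding inner_ell2_def by (subst cinner_commute) simp
  show "inner (x + y) z = inner x z + inner y z" by (simp add: inner_ell2_def cinner_add_left)
  show "inner (r *\<^sub>R x) y = r * inner x y"
    by (simp add: inner_ell2_def scaleR_ell2_def cinner_scaleC_left)
  show "0 \<le> inner x x" by (simp add: inner_ell2_def cinner_self infsum_nonneg)
  show "norm x = sqrt (inner x x)" by (simp add: norm_ell2_def inner_ell2_def cinner_self)
  show "inner x x = 0 \<longleftrightarrow> x = 0"
  proof
    assume "inner x x = 0"
    then have "(\<Sum>\<^sub>\<infinity>i. (cmod (coord x i))\<^sup>2) = 0" by (simp add: inner_ell2_def cinner_self)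
    then have "(cmod (coord x i))\<^sup>2 = 0" for i
      using nonneg_infsum_le_0D[of "\<lambda>i. (cmod (coord x i))\<^sup>2" UNIV i] coord_summable[of x] by simp
    then show "x = 0" by (intro ell2_eqI) (simp add: coord_simps)
  qed (simp add: inner_ell2_def cinner_def coord_simps)
qed

end

section \<open>Bounded operators\<close>

definition bounded_clinear :: "('a ell2 \<Rightarrow> 'a ell2) \<Rightarrow> bool" where
  "bounded_clinear T \<longleftrightarrow> bounded_linear T \<and> (\<forall>a x. T (a *\<^sub>C x) = a *\<^sub>C T x)"

definition hadjoint :: "('a ell2 \<Rightarrow> 'a ell2) \<Rightarrow> 'a ell2 \<Rightarrow> 'a ell2" where
  "hadjoint T = (THE S. \<forall>x y. cinner (S x) y = cinner x (T y))"

definition spectral_set :: "('a ell2 \<Rightarrow> 'a ell2) \<Rightarrow> complex set" where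
  "spectral_set X = {z. \<not> (\<exists>R. bounded_clinear R \<and>
      R \<circ> (\<lambda>x. z *\<^sub>C x - X x) = id \<and> (\<lambda>x. z *\<^sub>C x - X x) \<circ> R = id)}"

lemma hadjoint_eqI:
  assumes "\<And>x y. cinner (S x) y = cinner x (T y)"
  shows "hadjoint T = S"
  unfolding hadjoint_def
proof (rule the_equality)
  fix S' assume S': "\<forall>x y. cinner (S' x) y = cinner x (T y)"
  show "S' = S"
  proof
    fix x
    have "cinner (S' x + (-1) *\<^sub>C S x) y = 0" for y
      unfolding cinner_add_left cinner_scaleC_left using S' assms by simp
    then have "inner (S' x + (-1) *\<^sub>C S x) (S' x + (-1) *\<^sub>C S x) = 0"
      by (simp add: inner_ell2_def)
    then have "S' x + (-1) *\<^sub>C S x = 0" by simp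
    moreover have "(-1) *\<^sub>C S x = - S x" by (rule ell2_eqI) (simp add: coord_simps)
    ultimately show "S' x = S x" by simp
  qed
qed (use assms in simp)

section \<open>Full Fock space\<close>

text \<open>The full Fock space over \<open>\<complex>\<^sup>n\<close>: the word \<open>[i\<^sub>1, \<dots>, i\<^sub>k]\<close> indexes the vector
  \<open>\<delta>\<^bsub>i\<^sub>1\<^esub> \<otimes> \<dots> \<otimes> \<delta>\<^bsub>i\<^sub>k\<^esub>\<close> of \<open>(\<complex>\<^sup>n)\<^bsup>\<otimes>k\<^esup>\<close>, where \<open>\<delta>\<close> is the coordinate basis of \<open>\<complex>\<^sup>n\<close>,
  and the empty word indexes the vacuum \<open>\<Omega>\<close>.\<close>

type_synonym 'n fock = "'n list ell2"

lemma UNIV_list_decomp: "(UNIV :: 'n list set) = insert [] (\<Union>i. range ((#) i))"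
proof -
  have "w \<in> insert [] (\<Union>i. range ((#) i))" for w :: "'n list"
    by (cases w) auto
  then show ?thesis by blast
qed

text \<open>\<open>creation \<xi> x = \<xi> \<otimes> x\<close>, with \<open>\<xi> \<otimes> \<Omega> = \<xi>\<close>.\<close>

lift_definition creation :: "complex^'n::finite \<Rightarrow> 'n fock \<Rightarrow> 'n fock" is
  "\<lambda>\<xi> x w. case w of [] \<Rightarrow> 0 | i # v \<Rightarrow> \<xi> $ i * x v"
proof -
  fix \<xi> :: "complex^'n" and x :: "'n list \<Rightarrow> complex"
  assume x: "(\<lambda>w. (cmod (x w))\<^sup>2) summable_on UNIV"
  define g where "g w = (cmod (case w of [] \<Rightarrow> 0 | i # v \<Rightarrow> \<xi> $ i * x v))\<^sup>2" for w
  have "g summable_on range ((#) i)" for i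
    using ell2_cmult_summable[OF x, of "\<xi> $ i"]
    by (subst summable_on_reindex) (auto simp: g_def o_def)
  then have "g summable_on (\<Union>i. range ((#) i))"
    by (intro summable_on_finite_union_disjoint) auto
  then have "g summable_on insert [] (\<Union>i. range ((#) i))"
    by (simp add: summable_on_insert_iff)
  then show "(\<lambda>w. (cmod (case w of [] \<Rightarrow> 0 | i # v \<Rightarrow> \<xi> $ i * x v))\<^sup>2) summable_on UNIV"
    unfolding g_def by (subst UNIV_list_decomp)
qed

definition annihilation :: "complex^'n::finite \<Rightarrow> 'n fock \<Rightarrow> 'n fock" where
  "annihilation \<xi> = hadjoint (creation \<xi>)"

text \<open>The adjoint exists, so the definite description in \<open>hadjoint\<close> is meaningful here:
  \<open>annihilation \<xi>\<close> kills the vacuum and maps \<open>\<eta> \<otimes> x\<close> to \<open>\<langle>\<xi>, \<eta>\<rangle> x\<close>.\<close>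

lift_definition left_contraction :: "complex^'n::finite \<Rightarrow> 'n fock \<Rightarrow> 'n fock" is
  "\<lambda>\<xi> x w. \<Sum>i\<in>UNIV. cnj (\<xi> $ i) * x (i # w)"
proof -
  fix \<xi> :: "complex^'n" and x :: "'n list \<Rightarrow> complex"
  assume x: "(\<lambda>w. (cmod (x w))\<^sup>2) summable_on UNIV"
  have 1: "(\<lambda>w. (cmod (x (i#w)))\<^sup>2) summable_on UNIV" for i
    using summable_on_reindex[of "(#) i" UNIV "\<lambda>w. (cmod (x w))\<^sup>2"] summable_on_subset_banach[OF x, of "range ((#) i)"]
    by (auto simp: o_def)
  have "finite I \<Longrightarrow> (\<lambda>w. (cmod (\<Sum>i\<in>I. cnj (\<xi> $ i) * x (i # w)))\<^sup>2) summable_on UNIV" for I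
    by (induction I rule: finite_induct) (auto intro!: ell2_add_summable ell2_cmult_summable 1)
  then show "(\<lambda>w. (cmod (\<Sum>i\<in>UNIV. cnj (\<xi> $ i) * x (i # w)))\<^sup>2) summable_on UNIV" by simp
qed

lemma annihilation_eq: "annihilation \<xi> = left_contraction \<xi>"
  unfolding annihilation_def
proof (rule hadjoint_eqI)
  fix x y
  let ?h = "\<lambda>w. cnj (coord x w) * coord (creation \<xi> y) w"
  have s: "?h summable_on UNIV" by (rule cinner_summable)
  have si: "?h summable_on range ((#) i)" for i
    using summable_on_subset_banach[OF s] by simp
  have "cinner x (creation \<xi> y) = infsum ?h (insert [] (\<Union>i. range ((#) i)))"
    unfolding cinner_def by (subst UNIV_list_decomp) (rule refl)
  also have "\<dots> = infsum ?h (\<Union>i. range ((#) i))"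
    by (rule infsum_cong_neutral) (auto simp: creation.rep_eq)
  also have "\<dots> = (\<Sum>i\<in>UNIV. infsum ?h (range ((#) i)))"
    using si by (subst sum_infsum) auto
  also have "\<dots> = (\<Sum>i\<in>UNIV. \<Sum>\<^sub>\<infinity>v. cnj (coord x (i#v)) * (\<xi>$i * coord y v))"
    by (subst infsum_reindex) (auto simp: o_def creation.rep_eq)
  also have "\<dots> = (\<Sum>\<^sub>\<infinity>v. \<Sum>i\<in>UNIV. cnj (coord x (i#v)) * (\<xi>$i * coord y v))"
  proof -
    have 1: "(\<lambda>v. cnj (coord x (i#v)) * (\<xi>$i * coord y v)) summable_on UNIV" for i
      using si[of i] summable_on_reindex[of "(#) i" UNIV ?h] by (auto simp: o_def creation.rep_eq)
    have "finite I \<Longrightarrow> ((\<lambda>v. \<Sum>i\<in>I. cnj (coord x (i#v)) * (\<xi>$i * coord y v)) has_sum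
      (\<Sum>i\<in>I. \<Sum>\<^sub>\<infinity>v. cnj (coord x (i#v)) * (\<xi>$i * coord y v))) UNIV" for I
      by (induction I rule: finite_induct) (auto intro!: has_sum_add has_sum_infsum 1)
    from infsumI[OF this[of UNIV]] show ?thesis by simp
  qed
  also have "\<dots> = cinner (left_contraction \<xi> x) y"
    unfolding cinner_def by (simp add: left_contraction.rep_eq sum_distrib_right mult.assoc mult.left_commute)
  finally show "cinner (left_contraction \<xi> x) y = cinner x (creation \<xi> y)" by simp
qed

section \<open>Free circular random variables\<close>

definition cdot :: "complex^'n::finite \<Rightarrow> complex^'n \<Rightarrow> complex" where
  "cdot u v = (\<Sum>i\<in>UNIV. cnj (u $ i) * v $ i)"

definition orthonormal_basis :: "('n \<Rightarrow> complex^'n::finite) \<Rightarrow> bool" where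
  "orthonormal_basis e \<longleftrightarrow>
    (\<forall>i j. cdot (e i) (e j) = (if i = j then 1 else 0)) \<and> vec.span (range e) = UNIV"

definition semicircular :: "(4 \<Rightarrow> complex^4) \<Rightarrow> 4 \<Rightarrow> 4 fock \<Rightarrow> 4 fock" where
  "semicircular e j x = creation (e j) x + annihilation (e j) x"

text \<open>\<open>\<iota>\<close> is the inclusion \<open>{1, 2} \<subseteq> {1, 2, 3, 4}\<close> of index sets, as types \<open>2\<close> and \<open>4\<close>.\<close>

definition circular :: "(4 \<Rightarrow> complex^4) \<Rightarrow> 2 \<Rightarrow> 4 fock \<Rightarrow> 4 fock" where
  "circular e i x = (let \<iota> = (\<lambda>k::2. if k = 1 then 1 else 2 :: 4) in
    (1 / complex_of_real (sqrt 2)) *\<^sub>C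
      (semicircular e (\<iota> i) x + \<i> *\<^sub>C semicircular e (2 + \<iota> i) x))"

definition quadratic_poly ::
  "complex^2^2 \<Rightarrow> complex^2 \<Rightarrow> (2 \<Rightarrow> 'a ell2 \<Rightarrow> 'a ell2) \<Rightarrow> 'a ell2 \<Rightarrow> 'a ell2" where
  "quadratic_poly A b c x =
    (\<Sum>i\<in>UNIV. \<Sum>j\<in>UNIV. (A $ i $ j) *\<^sub>C c i (c j x)) + (\<Sum>i\<in>UNIV. (b $ i) *\<^sub>C c i x)"

section \<open>The matrix \<open>Q\<close>\<close>

definition cnj_vec :: "complex^'n \<Rightarrow> complex^'n" where
  "cnj_vec v = (\<chi> i. cnj (v $ i))"

definition ctranspose :: "complex^'n^'m \<Rightarrow> complex^'m^'n" where
  "ctranspose M = map_matrix cnj (transpose M)"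

definition Q_matrix :: "complex^2^2 \<Rightarrow> complex^2 \<Rightarrow> complex^6^6" where
  "Q_matrix A b = (
    let B = map_matrix cnj A;
        d = cnj_vec b;
        r = d v* A;
        s = b v* B
    in vector [
      vector [cdot b b, trace (ctranspose A ** A), r $ 1, r $ 2, s $ 1, s $ 2],
      vector [1,     0, 0,         0,         0,         0],
      vector [d $ 1, 0, 0,         0,         B $ 1 $ 1, B $ 1 $ 2],
      vector [d $ 2, 0, 0,         0,         B $ 2 $ 1, B $ 2 $ 2],
      vector [b $ 1, 0, A $ 1 $ 1, A $ 1 $ 2, 0,         0],
      vector [b $ 2, 0, A $ 2 $ 1, A $ 2 $ 2, 0,         0]])"

text \<open>The class operation \<open>^\<close> on matrices would be entrywise.\<close>

definition matrix_pow :: "'a::semiring_1^'n::finite^'n \<Rightarrow> nat \<Rightarrow> 'a^'n^'n" where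
  "matrix_pow M n = (((**) M) ^^ n) (mat 1)"

end

theory Submission
  imports Defs
begin

text \<open>
  Write \<open>c\<^sub>i = l(f\<^sub>i) + l\<^sup>*(g\<^sub>i)\<close> with \<open>f\<^sub>1, f\<^sub>2, g\<^sub>1, g\<^sub>2\<close> orthonormal, so that \<open>l\<^sup>*(g\<^sub>i) l(f\<^sub>j) = 0\<close>, and rescale
  to \<open>\<lambda> = 1\<close>. Let \<open>F\<close> be the polynomial in the \<open>c\<^sub>i\<close>, \<open>F\<^sub>L\<close> and \<open>F\<^sub>G\<close> the same polynomial in the
  \<open>l(f\<^sub>i)\<close> and in the \<open>l\<^sup>*(g\<^sub>i)\<close>, and \<open>K = \<Sum> a\<^sub>i\<^sub>j l(f\<^sub>i) l\<^sup>*(g\<^sub>j)\<close>. Then \<open>1 - F = (1 - F\<^sub>G)(1 - K)(1 - F\<^sub>L)\<close> and \<open>K\<^sup>2 = 0\<close>. The degree \<open>n\<close> part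
  \<open>Y\<^sub>n\<close> of \<open>(1 - F\<^sub>L)\<^sup>-\<^sup>1\<close> is a multiple of an isometry, and \<open>Q\<^sup>n e\<^sub>1\<close> consists of the inner products of
  \<open>Y\<^sub>n\<close> and \<open>l(f\<^sub>i) Y\<^sub>n\<^sub>-\<^sub>1\<close>; in particular its first entry is \<open>\<parallel>Y\<^sub>n\<parallel>\<^sup>2\<close>. If that tends to 0, the partial
  sums of \<open>\<Sum> Y\<^sub>n\<close> invert \<open>1 - F\<^sub>L\<close> up to a small error, and dually for \<open>F\<^sub>G\<close>.
  Conversely, right creation by \<open>f\<^sub>j\<close> commutes with both \<open>c\<^sub>i\<close>, hence with \<open>R = (\<lambda> - F)\<^sup>-\<^sup>1\<close>. This yields an
  equation for \<open>R\<Omega>\<close>, which is contradictory for \<open>\<lambda> = 0\<close> and whose solution for \<open>\<lambda> = 1\<close> has the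
  degree \<open>n\<close> part \<open>Y\<^sub>n\<Omega>\<close>; so \<open>Y\<^sub>n\<Omega> \<rightarrow> 0\<close>.
\<close>

section \<open>The Hilbert space of square-summable families\<close>

lemma scaleC_simps:
  fixes x y :: "'a ell2"
  shows "a *\<^sub>C (x + y) = a *\<^sub>C x + a *\<^sub>C y" "a *\<^sub>C (x - y) = a *\<^sub>C x - a *\<^sub>C y"
    "(a + c) *\<^sub>C x = a *\<^sub>C x + c *\<^sub>C x" "a *\<^sub>C c *\<^sub>C x = (a * c) *\<^sub>C x" "1 *\<^sub>C x = x"
    "a *\<^sub>C 0 = (0 :: 'a ell2)" "0 *\<^sub>C x = 0" "a *\<^sub>C (- x) = - (a *\<^sub>C x)"
  by (rule ell2_eqI; simp add: coord_simps algebra_simps)+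

lemma scaleR_scaleC: "r *\<^sub>R x = complex_of_real r *\<^sub>C x" for x :: "'a ell2"
  by (rule scaleR_ell2_def)

lemma cinner_add_right: "cinner x (y + z) = cinner x y + cinner x z" for x y z :: "'a ell2"
  by (subst (1 2 3) cinner_commute) (simp add: cinner_add_left)

lemma cinner_scaleC_right: "cinner x (a *\<^sub>C y) = a * cinner x y" for x y :: "'a ell2"
  by (subst (1 2) cinner_commute) (simp add: cinner_scaleC_left)

lemma cinner_zero: "cinner 0 x = 0" "cinner x 0 = 0" for x :: "'a ell2"
  by (simp_all add: cinner_def coord_simps)

lemmas cinner_simps =
  cinner_add_left cinner_add_right cinner_scaleC_left cinner_scaleC_right cinner_zero

lemma cinner_self_norm: "cinner x x = complex_of_real ((norm x)\<^sup>2)" for x :: "'a ell2"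
  by (simp add: cinner_self norm_ell2_def infsum_nonneg)

lemma norm_scaleC: "norm (a *\<^sub>C x) = cmod a * norm x" for x :: "'a ell2"
proof -
  have "complex_of_real ((norm (a *\<^sub>C x))\<^sup>2) = (a * cnj a) * cinner x x"
    unfolding cinner_self_norm[symmetric] by (simp add: cinner_simps)
  also have "\<dots> = complex_of_real ((cmod a * norm x)\<^sup>2)"
    unfolding cinner_self_norm complex_norm_square[symmetric]
    by (simp add: power_mult_distrib)
  finally have "(norm (a *\<^sub>C x))\<^sup>2 = (cmod a * norm x)\<^sup>2" by (simp only: of_real_eq_iff)
  then show ?thesis by (simp add: power2_eq_iff_nonneg)
qed

text \<open>Taking moduli of both sides spares a proof that \<open>q\<close> is real and
  nonnegative.\<close>

lemma norm_eq_of_cinner: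
  assumes "cinner (T x) (T x) = q * cinner x x"
  shows "norm (T x) = sqrt (cmod q) * norm x"
proof -
  from assms have "cmod (complex_of_real ((norm (T x))\<^sup>2)) = cmod (q * complex_of_real ((norm x)\<^sup>2))"
    by (simp only: cinner_self_norm)
  then have "(norm (T x))\<^sup>2 = (sqrt (cmod q) * norm x)\<^sup>2"
    by (simp add: power_mult_distrib norm_mult norm_power)
  then show ?thesis by (simp add: power2_eq_iff_nonneg)
qed

lemma cnj_sgn_mult: "cnj (sgn z) * z = complex_of_real (cmod z)"
proof (cases "z = 0")
  case False
  have "cnj (sgn z) * z = cnj z * z / complex_of_real (cmod z)" by (simp add: sgn_eq)
  also have "cnj z * z = (complex_of_real (cmod z))\<^sup>2"
    by (simp add: complex_norm_square mult.commute flip: of_real_power)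
  finally show ?thesis using False by (simp add: power2_eq_square)
qed simp

lemma cmod_cinner_le: "cmod (cinner x y) \<le> norm x * norm y" for x y :: "'a ell2"
proof -
  \<comment> \<open>This phase rotates \<open>y\<close> so that the inner product becomes its own
    modulus, and the real Cauchy-Schwarz inequality applies.\<close>
  define t where "t = cnj (sgn (cinner x y))"
  have "cmod (cinner x y) = inner x (t *\<^sub>C y)"
    unfolding t_def inner_ell2_def cinner_scaleC_right cnj_sgn_mult by simp
  also have "\<dots> \<le> norm x * norm (t *\<^sub>C y)" by (rule norm_cauchy_schwarz)
  also have "\<dots> \<le> norm x * norm y"
  proof (rule mult_left_mono)
    have "cmod t \<le> 1" by (simp add: t_def norm_sgn)
    then show "norm (t *\<^sub>C y) \<le> norm y"
      unfolding norm_scaleC by (rule mult_left_le_one_le[rotated 2]) simp_all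
  qed simp
  finally show ?thesis .
qed

lemma norm_ell2_finite_sum_le:
  fixes x :: "'a ell2"
  assumes "finite F"
  shows "(\<Sum>i\<in>F. (cmod (coord x i))\<^sup>2) \<le> (norm x)\<^sup>2"
proof -
  have "(\<Sum>i\<in>F. (cmod (coord x i))\<^sup>2) \<le> (\<Sum>\<^sub>\<infinity>i. (cmod (coord x i))\<^sup>2)"
    by (rule finite_sum_le_infsum) (simp_all add: assms coord_summable)
  then show ?thesis by (simp add: norm_ell2_def infsum_nonneg)
qed

lemma norm_ell2_le:
  fixes x :: "'a ell2"
  assumes "\<And>F. finite F \<Longrightarrow> (\<Sum>i\<in>F. (cmod (coord x i))\<^sup>2) \<le> c\<^sup>2" "0 \<le> c"
  shows "norm x \<le> c"
proof -
  have "(\<Sum>\<^sub>\<infinity>i. (cmod (coord x i))\<^sup>2) \<le> c\<^sup>2"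
    by (rule infsum_le_finite_sums) (simp_all add: assms coord_summable)
  then show ?thesis unfolding norm_ell2_def using assms(2) by (intro real_le_lsqrt) auto
qed

lemma cmod_coord_le: "cmod (coord x i) \<le> norm x" for x :: "'a ell2"
  by (rule power2_le_imp_le) (use norm_ell2_finite_sum_le[of "{i}" x] in simp_all)

text \<open>Coordinates converge by \<open>cmod_coord_le\<close>, and bounds on finite partial sums
  survive the coordinatewise limit. Completeness is what the fixed point argument in
  \<open>invertible_op_id_minus\<close> rests on.\<close>

instance ell2 :: (type) banach
proof
  fix X :: "nat \<Rightarrow> 'a ell2"
  assume X: "Cauchy X"
  have "Cauchy (\<lambda>n. coord (X n) i)" for i
  proof (rule metric_CauchyI)
    fix e :: real assume "e > 0"
    from metric_CauchyD[OF X this]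
    obtain N where N: "\<And>m n. m \<ge> N \<Longrightarrow> n \<ge> N \<Longrightarrow> dist (X m) (X n) < e" by blast
    have "dist (coord (X m) i) (coord (X n) i) < e" if "m \<ge> N" "n \<ge> N" for m n
      using N[OF that] cmod_coord_le[of "X m - X n" i] by (simp add: dist_norm coord_simps)
    then show "\<exists>M. \<forall>m\<ge>M. \<forall>n\<ge>M. dist (coord (X m) i) (coord (X n) i) < e" by blast
  qed
  then have "\<exists>l. (\<lambda>n. coord (X n) i) \<longlonglongrightarrow> l" for i
    by (metis Cauchy_convergent_iff convergent_def)
  then obtain l where l: "\<And>i. (\<lambda>n. coord (X n) i) \<longlonglongrightarrow> l i" by metis
  have tail: "\<exists>N. \<forall>m\<ge>N. \<forall>F. finite F \<longrightarrow> (\<Sum>i\<in>F. (cmod (coord (X m) i - l i))\<^sup>2) \<le> e\<^sup>2"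
    if "e > 0" for e
  proof -
    from metric_CauchyD[OF X that]
    obtain N where N: "\<And>m n. m \<ge> N \<Longrightarrow> n \<ge> N \<Longrightarrow> dist (X m) (X n) < e" by blast
    have "(\<Sum>i\<in>F. (cmod (coord (X m) i - l i))\<^sup>2) \<le> e\<^sup>2" if m: "m \<ge> N" and F: "finite F" for m F
    proof (rule LIMSEQ_le_const2)
      show "(\<lambda>n. \<Sum>i\<in>F. (cmod (coord (X m) i - coord (X n) i))\<^sup>2)
          \<longlonglongrightarrow> (\<Sum>i\<in>F. (cmod (coord (X m) i - l i))\<^sup>2)"
        by (intro tendsto_intros l)
      have "(\<Sum>i\<in>F. (cmod (coord (X m) i - coord (X n) i))\<^sup>2) \<le> e\<^sup>2" if "n \<ge> N" for n
      proof -
        have "(\<Sum>i\<in>F. (cmod (coord (X m - X n) i))\<^sup>2) \<le> (norm (X m - X n))\<^sup>2"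
          by (rule norm_ell2_finite_sum_le[OF F])
        also have "\<dots> \<le> e\<^sup>2"
          using N[OF m that] by (intro power_mono) (auto simp: dist_norm)
        finally show ?thesis by (simp add: coord_simps)
      qed
      then show "\<exists>N. \<forall>n\<ge>N. (\<Sum>i\<in>F. (cmod (coord (X m) i - coord (X n) i))\<^sup>2) \<le> e\<^sup>2" by blast
    qed
    then show ?thesis by blast
  qed
  \<comment> \<open>The limit \<open>l\<close> is square-summable because it is \<open>X M\<close>
    minus the square-summable difference \<open>X M - l\<close>.\<close>
  from tail[of 1] obtain M where
    M: "\<And>F. finite F \<Longrightarrow> (\<Sum>i\<in>F. (cmod (coord (X M) i - l i))\<^sup>2) \<le> 1" by auto
  have "(\<lambda>i. (cmod (coord (X M) i - l i))\<^sup>2) summable_on UNIV"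
    by (rule nonneg_bdd_above_summable_on) (auto intro!: bdd_aboveI2[where M = 1] M)
  then have "(\<lambda>i. (cmod (- 1 * (coord (X M) i - l i)))\<^sup>2) summable_on UNIV"
    by (rule ell2_cmult_summable)
  then have "(\<lambda>i. (cmod (coord (X M) i + - 1 * (coord (X M) i - l i)))\<^sup>2) summable_on UNIV"
    by (rule ell2_add_summable[OF coord_summable])
  then have "(\<lambda>i. (cmod (l i))\<^sup>2) summable_on UNIV" by simp
  then have co: "coord (Abs_ell2 l) = l" by (intro Abs_ell2_inverse) simp
  have "X \<longlonglongrightarrow> Abs_ell2 l"
  proof (rule metric_LIMSEQ_I)
    fix e :: real assume "e > 0"
    with tail[of "e/2"] obtain N where
      N: "\<And>m F. m \<ge> N \<Longrightarrow> finite F \<Longrightarrow> (\<Sum>i\<in>F. (cmod (coord (X m) i - l i))\<^sup>2) \<le> (e/2)\<^sup>2" by auto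
    have "dist (X m) (Abs_ell2 l) < e" if "m \<ge> N" for m
    proof -
      have "norm (X m - Abs_ell2 l) \<le> e/2"
        by (rule norm_ell2_le) (use N[OF that] \<open>e > 0\<close> in \<open>simp_all add: coord_simps co\<close>)
      then show ?thesis using \<open>e > 0\<close> by (simp add: dist_norm)
    qed
    then show "\<exists>N. \<forall>m\<ge>N. dist (X m) (Abs_ell2 l) < e" by blast
  qed
  then show "convergent X" by (rule convergentI)
qed

section \<open>Bounded operators\<close>

lemma bounded_clinearI:
  assumes "\<And>x y. T (x + y) = T x + T y" "\<And>a x. T (a *\<^sub>C x) = a *\<^sub>C T x"
    "\<And>x. norm (T x) \<le> norm x * K"
  shows "bounded_clinear T"
  unfolding bounded_clinear_def
  by (intro conjI bounded_linear_intro[where K = K]) (auto simp: assms scaleR_scaleC)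

lemma bounded_clinear_imp:
  assumes "bounded_clinear T"
  shows "bounded_linear T" "T (x + y) = T x + T y" "T (a *\<^sub>C x) = a *\<^sub>C T x"
    "T (x - y) = T x - T y" "T 0 = 0"
proof -
  show bl: "bounded_linear T" and "T (a *\<^sub>C x) = a *\<^sub>C T x"
    using assms by (simp_all add: bounded_clinear_def)
  interpret bounded_linear T by (rule bl)
  show "T (x + y) = T x + T y" "T (x - y) = T x - T y" "T 0 = 0"
    by (rule add diff zero)+
qed

lemma bounded_clinear_id: "bounded_clinear id"
  by (rule bounded_clinearI[where K = 1]) auto

lemma bounded_clinear_comp:
  assumes "bounded_clinear S" "bounded_clinear T"
  shows "bounded_clinear (\<lambda>x. S (T x))"
  using assms bounded_linear_compose unfolding bounded_clinear_def by auto

lemma bounded_clinear_add: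
  assumes "bounded_clinear S" "bounded_clinear T"
  shows "bounded_clinear (\<lambda>x. S x + T x)"
  using assms bounded_linear_add unfolding bounded_clinear_def by (auto simp: scaleC_simps)

lemma bounded_clinear_diff:
  assumes "bounded_clinear S" "bounded_clinear T"
  shows "bounded_clinear (\<lambda>x. S x - T x)"
  using assms bounded_linear_sub unfolding bounded_clinear_def by (auto simp: scaleC_simps)

lemma bounded_clinear_zero: "bounded_clinear (\<lambda>x. 0)"
  by (rule bounded_clinearI[where K = 0]) (auto simp: scaleC_simps)

lemma bounded_clinear_sum:
  assumes "\<And>i. i \<in> I \<Longrightarrow> bounded_clinear (T i)"
  shows "bounded_clinear (\<lambda>x. \<Sum>i\<in>I. T i x)"
proof (cases "finite I")
  case True
  then show ?thesis using assms
    by (induction I) (auto intro!: bounded_clinear_add simp: bounded_clinear_zero)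
qed (simp add: bounded_clinear_zero)

lemma bounded_clinear_ident: "bounded_clinear (\<lambda>x. x)"
  using bounded_clinear_id by (simp add: id_def)

lemma bounded_clinear_scaleC:
  assumes "bounded_clinear T"
  shows "bounded_clinear (\<lambda>x. a *\<^sub>C T x)"
proof -
  have "bounded_clinear (\<lambda>x :: 'a ell2. a *\<^sub>C x)"
    by (rule bounded_clinearI[where K = "cmod a"]) (auto simp: scaleC_simps norm_scaleC ac_simps)
  from bounded_clinear_comp[OF this assms] show ?thesis .
qed

lemmas bounded_clinear_intros =
  bounded_clinear_ident bounded_clinear_add bounded_clinear_diff bounded_clinear_scaleC
  bounded_clinear_sum

lemma bounded_clinear_bound:
  assumes "bounded_clinear T"
  obtains K where "0 < K" "\<And>x. norm (T x) \<le> K * norm x"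
  using bounded_linear.pos_bounded[OF bounded_clinear_imp(1)[OF assms]] that
  by (auto simp: mult.commute)

section \<open>Invertibility criteria for bounded operators\<close>

definition invertible_op :: "('a ell2 \<Rightarrow> 'a ell2) \<Rightarrow> bool" where
  "invertible_op T \<longleftrightarrow> (\<exists>R. bounded_clinear R \<and> R \<circ> T = id \<and> T \<circ> R = id)"

lemma spectral_set_iff: "z \<in> spectral_set X \<longleftrightarrow> \<not> invertible_op (\<lambda>x. z *\<^sub>C x - X x)"
  by (simp add: spectral_set_def invertible_op_def)

lemma invertible_op_comp:
  assumes "invertible_op S" "invertible_op T"
  shows "invertible_op (\<lambda>x. S (T x))"
proof -
  from assms obtain R R' where R: "bounded_clinear R" "R \<circ> S = id" "S \<circ> R = id"
    and R': "bounded_clinear R'" "R' \<circ> T = id" "T \<circ> R' = id"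
    unfolding invertible_op_def by blast
  have "(\<lambda>x. R' (R x)) \<circ> (\<lambda>x. S (T x)) = id" "(\<lambda>x. S (T x)) \<circ> (\<lambda>x. R' (R x)) = id"
    using R R' by (auto simp: fun_eq_iff)
  then show ?thesis unfolding invertible_op_def
    using bounded_clinear_comp[OF R'(1) R(1)] by blast
qed

lemma invertible_op_scaleC:
  assumes "z \<noteq> 0"
  shows "invertible_op (\<lambda>x. z *\<^sub>C T x) \<longleftrightarrow> invertible_op T"
proof -
  have s: "invertible_op (\<lambda>x :: 'b ell2. c *\<^sub>C x)" if "c \<noteq> 0" for c
    unfolding invertible_op_def
    by (rule exI[of _ "\<lambda>x. inverse c *\<^sub>C x"])
      (use that in \<open>auto intro!: bounded_clinear_intros simp: fun_eq_iff scaleC_simps\<close>)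
  have "invertible_op T" if "invertible_op (\<lambda>x. z *\<^sub>C T x)"
    using invertible_op_comp[OF s[of "inverse z"] that] assms by (simp add: scaleC_simps)
  then show ?thesis using invertible_op_comp[OF s[OF assms]] by blast
qed

text \<open>\<open>R P\<close> is a left inverse and \<open>P S\<close> a right inverse of
  \<open>T\<close>, so the two agree. Thus an approximate inverse \<open>P\<close> suffices,
  provided that it is good on both sides.\<close>

lemma invertible_op_two_sided:
  assumes P: "bounded_clinear P"
    and l: "invertible_op (\<lambda>x. P (T x))" and r: "invertible_op (\<lambda>x. T (P x))"
  shows "invertible_op T"
proof -
  from l obtain R where R: "bounded_clinear R" "\<And>x. R (P (T x)) = x"
    unfolding invertible_op_def by (auto simp: fun_eq_iff)
  from r obtain S where S: "\<And>x. T (P (S x)) = x"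
    unfolding invertible_op_def by (auto simp: fun_eq_iff)
  have "R (P x) = P (S x)" for x
    using R(2)[of "P (S x)"] S[of x] by simp
  then have "(\<lambda>x. R (P x)) \<circ> T = id" "T \<circ> (\<lambda>x. R (P x)) = id"
    using R(2) S by (auto simp: fun_eq_iff)
  with bounded_clinear_comp[OF R(1) P] show ?thesis unfolding invertible_op_def by blast
qed

text \<open>The equation \<open>x - E x = y\<close> says that \<open>x\<close> is the fixed point of
  the contraction that sends \<open>x\<close> to \<open>y + E x\<close>. This replaces the Neumann
  series.\<close>

lemma invertible_op_id_minus:
  assumes E: "bounded_clinear E" and q: "q < 1" "\<And>x. norm (E x) \<le> q * norm x"
  shows "invertible_op (\<lambda>x. x - E x)"
proof -
  note lin = bounded_clinear_imp[OF E]
  have ex: "\<exists>!x. x - E x = y" for y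
  proof -
    have "\<exists>!x. y + E x = x"
    \<comment> \<open>The fixed point theorem wants a nonnegative constant, whereas \<open>q\<close>
      may be negative.\<close>
    proof (rule banach_fix_type[of "max q 0"])
      show "\<forall>x x'. dist (y + E x) (y + E x') \<le> max q 0 * dist x x'"
      proof (intro allI)
        fix x x'
        have "norm (E (x - x')) \<le> max q 0 * norm (x - x')"
          using q(2)[of "x - x'"] by (meson max.cobounded1 mult_right_mono norm_ge_zero order_trans)
        then show "dist (y + E x) (y + E x') \<le> max q 0 * dist x x'"
          by (simp add: dist_norm lin)
      qed
    qed (use q in auto)
    moreover have "y + E x = x \<longleftrightarrow> x - E x = y" for x by (auto simp: algebra_simps)
    ultimately show ?thesis by simp
  qed
  define R where "R y = (THE x. x - E x = y)" for y
  have R: "R y - E (R y) = y" for y unfolding R_def by (rule theI'[OF ex])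
  have R': "R (x - E x) = x" for x unfolding R_def by (rule the1_equality[OF ex]) simp
  have "bounded_clinear R"
  proof (rule bounded_clinearI)
    show "R (x + y) = R x + R y" for x y
    proof -
      have "R x + R y - E (R x + R y) = (R x - E (R x)) + (R y - E (R y))" by (simp add: lin)
      also have "\<dots> = x + y" by (simp only: R)
      finally show ?thesis using R'[of "R x + R y"] by simp
    qed
    show "R (a *\<^sub>C x) = a *\<^sub>C R x" for a x
    proof -
      have "a *\<^sub>C R x - E (a *\<^sub>C R x) = a *\<^sub>C (R x - E (R x))" by (simp add: lin scaleC_simps)
      also have "\<dots> = a *\<^sub>C x" by (simp only: R)
      finally show ?thesis using R'[of "a *\<^sub>C R x"] by simp
    qed
    show "norm (R x) \<le> norm x * (1 / (1 - q))" for x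
    proof -
      have "norm (R x) \<le> norm x + norm (E (R x))"
        using norm_triangle_ineq[of x "E (R x)"] R[of x] by (simp add: algebra_simps)
      then have "(1 - q) * norm (R x) \<le> norm x"
        using q(2)[of "R x"] by (simp add: algebra_simps)
      then show ?thesis using q(1) by (simp add: field_simps)
    qed
  qed
  then show ?thesis unfolding invertible_op_def using R R' by (intro exI[of _ R]) (auto simp: fun_eq_iff)
qed

text \<open>The square of \<open>norm (T y)\<close> is the inner product of \<open>S (T y)\<close>
  with \<open>y\<close>. Cauchy-Schwarz and division by \<open>norm (T y)\<close> finish.\<close>

lemma norm_adjoint_le:
  fixes S T :: "'a ell2 \<Rightarrow> 'a ell2"
  assumes adj: "\<And>x y. cinner (S x) y = cinner x (T y)"
    and S: "\<And>x. norm (S x) \<le> s * norm x"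
  shows "norm (T y) \<le> s * norm y"
proof (cases "T y = 0")
  case True
  have "0 \<le> s * norm y"
    using S[of y] norm_ge_zero order_trans by blast
  then show ?thesis using True by simp
next
  case False
  have "(norm (T y))\<^sup>2 = inner (S (T y)) y"
    by (simp add: power2_norm_eq_inner inner_ell2_def adj)
  also have "\<dots> \<le> norm (S (T y)) * norm y" by (rule norm_cauchy_schwarz)
  also have "\<dots> \<le> (s * norm (T y)) * norm y" by (intro mult_right_mono S) simp
  finally have "norm (T y) * norm (T y) \<le> norm (T y) * (s * norm y)"
    by (simp add: power2_eq_square algebra_simps)
  with False show ?thesis by simp
qed

section \<open>Creation operators on the full Fock space\<close>

text \<open>Every nonempty word splits uniquely into its first letter and the rest: the Fock space
  is the vacuum line plus one copy of itself per letter.\<close>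

lemma infsum_list_decomp:
  fixes h :: "'n::finite list \<Rightarrow> complex"
  assumes "h summable_on UNIV"
  shows "(\<Sum>\<^sub>\<infinity>w. h w) = h [] + (\<Sum>i\<in>UNIV. \<Sum>\<^sub>\<infinity>v. h (i # v))"
    and "(\<lambda>v. h (i # v)) summable_on UNIV"
proof -
  have s: "h summable_on range ((#) i)" for i
    using summable_on_subset_banach[OF assms] by simp
  then show "(\<lambda>v. h (i # v)) summable_on UNIV"
    using summable_on_reindex[of "(#) i" UNIV h] by (simp add: o_def)
  have "(\<Sum>\<^sub>\<infinity>w. h w) = infsum h (insert [] (\<Union>i. range ((#) i)))"
    by (subst UNIV_list_decomp) (rule refl)
  also have "\<dots> = h [] + infsum h (\<Union>i. range ((#) i))"
    by (rule infsum_insert) (use summable_on_subset_banach[OF assms] in auto)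
  also have "infsum h (\<Union>i. range ((#) i)) = (\<Sum>i\<in>UNIV. infsum h (range ((#) i)))"
    using s by (subst sum_infsum) auto
  also have "\<dots> = (\<Sum>i\<in>UNIV. \<Sum>\<^sub>\<infinity>v. h (i # v))"
    by (subst infsum_reindex) (auto simp: o_def)
  finally show "(\<Sum>\<^sub>\<infinity>w. h w) = h [] + (\<Sum>i\<in>UNIV. \<Sum>\<^sub>\<infinity>v. h (i # v))" .
qed

lemma has_sum_sum:
  fixes f :: "'i \<Rightarrow> 'a \<Rightarrow> 'b::topological_comm_monoid_add"
  assumes "\<And>i. i \<in> I \<Longrightarrow> (f i has_sum s i) A"
  shows "((\<lambda>x. \<Sum>i\<in>I. f i x) has_sum (\<Sum>i\<in>I. s i)) A"
  using assms by (induction I rule: infinite_finite_induct) (auto intro!: has_sum_add)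

lemma cinner_left_contraction:
  fixes x y :: "'n::finite fock"
  shows "cinner (left_contraction \<xi> x) y = cinner x (creation \<xi> y)"
proof -
  let ?h = "\<lambda>w. cnj (coord x w) * coord (creation \<xi> y) w"
  note h = infsum_list_decomp[OF cinner_summable[of x "creation \<xi> y"]]
  have "cinner x (creation \<xi> y) = (\<Sum>i\<in>UNIV. \<Sum>\<^sub>\<infinity>v. ?h (i # v))"
    unfolding cinner_def h(1) by (simp add: creation.rep_eq)
  also have "\<dots> = (\<Sum>\<^sub>\<infinity>v. \<Sum>i\<in>UNIV. ?h (i # v))"
  proof -
    have "((\<lambda>v. \<Sum>i\<in>UNIV. ?h (i # v)) has_sum (\<Sum>i\<in>UNIV. \<Sum>\<^sub>\<infinity>v. ?h (i # v))) UNIV"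
      by (intro has_sum_sum has_sum_infsum h(2))
    then show ?thesis by (rule infsumI[symmetric])
  qed
  also have "\<dots> = cinner (left_contraction \<xi> x) y"
    unfolding cinner_def
    by (simp add: left_contraction.rep_eq creation.rep_eq sum_distrib_right mult.assoc mult.left_commute)
  finally show ?thesis by simp
qed

text \<open>Contraction removes exactly the letter just created. For orthogonal vectors the product
  is 0, which later yields \<open>GL\<close>.\<close>

lemma left_contraction_creation: "left_contraction \<eta> (creation \<xi> x) = cdot \<eta> \<xi> *\<^sub>C x"
  by (rule ell2_eqI)
    (simp add: left_contraction.rep_eq creation.rep_eq coord_simps cdot_def sum_distrib_right mult.assoc)

lemma cinner_creation: "cinner (creation \<xi> x) (creation \<eta> y) = cdot \<xi> \<eta> * cinner x y"
proof -
  have "cinner (creation \<eta> y) (creation \<xi> x) = cdot \<eta> \<xi> * cinner y x" for \<eta> \<xi> x y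
  proof -
    have "cinner (creation \<eta> y) (creation \<xi> x) = cinner (left_contraction \<xi> (creation \<eta> y)) x"
      by (rule cinner_left_contraction[symmetric])
    also have "\<dots> = cnj (cdot \<xi> \<eta>) * cinner y x"
      by (simp add: left_contraction_creation cinner_simps)
    also have "cnj (cdot \<xi> \<eta>) = cdot \<eta> \<xi>" by (simp add: cdot_def mult.commute)
    finally show ?thesis .
  qed
  then show ?thesis .
qed

lemma creation_linear:
  "creation \<xi> (x + y) = creation \<xi> x + creation \<xi> y"
  "creation \<xi> (a *\<^sub>C x) = a *\<^sub>C creation \<xi> x"
  by (rule ell2_eqI; simp add: creation.rep_eq coord_simps algebra_simps split: list.split)+

lemma left_contraction_linear:
  "left_contraction \<xi> (x + y) = left_contraction \<xi> x + left_contraction \<xi> y"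
  "left_contraction \<xi> (a *\<^sub>C x) = a *\<^sub>C left_contraction \<xi> x"
  by (rule ell2_eqI;
      simp add: left_contraction.rep_eq coord_simps algebra_simps sum.distrib sum_distrib_left)+

lemma creation_add_vec:
  "creation (\<xi> + \<eta>) x = creation \<xi> x + creation \<eta> x" "creation (a *s \<xi>) x = a *\<^sub>C creation \<xi> x"
  by (rule ell2_eqI; simp add: creation.rep_eq coord_simps algebra_simps split: list.split)+

lemma left_contraction_add_vec:
  "left_contraction (\<xi> + \<eta>) x = left_contraction \<xi> x + left_contraction \<eta> x"
  "left_contraction (a *s \<xi>) x = cnj a *\<^sub>C left_contraction \<xi> x"
  by (rule ell2_eqI;
      simp add: left_contraction.rep_eq coord_simps algebra_simps sum.distrib sum_distrib_left)+

lemma norm_creation: "norm (creation \<xi> x) = sqrt (cmod (cdot \<xi> \<xi>)) * norm x"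
  by (rule norm_eq_of_cinner) (rule cinner_creation)

lemma bounded_clinear_creation: "bounded_clinear (creation \<xi>)"
  by (rule bounded_clinearI[where K = "sqrt (cmod (cdot \<xi> \<xi>))"])
    (auto simp: creation_linear norm_creation)

lemma bounded_clinear_left_contraction: "bounded_clinear (left_contraction \<xi>)"
proof (rule bounded_clinearI)
  have "cinner (creation \<xi> x) y = cinner x (left_contraction \<xi> y)" for x y
    by (subst (1 2) cinner_commute) (simp add: cinner_left_contraction)
  then show "norm (left_contraction \<xi> x) \<le> norm x * sqrt (cmod (cdot \<xi> \<xi>))" for x
    using norm_adjoint_le[of "creation \<xi>" "left_contraction \<xi>" "sqrt (cmod (cdot \<xi> \<xi>))"]
    by (simp add: norm_creation mult.commute)
qed (simp_all add: left_contraction_linear)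

section \<open>Right creation, obtained by reversing words\<close>

lift_definition flip :: "'n fock \<Rightarrow> 'n fock" is "\<lambda>x w. x (rev w)"
proof -
  fix x :: "'n list \<Rightarrow> complex"
  assume "(\<lambda>w. (cmod (x w))\<^sup>2) summable_on UNIV"
  moreover have "bij (rev :: 'n list \<Rightarrow> 'n list)"
    by (rule o_bij[of rev]) (auto simp: fun_eq_iff)
  ultimately show "(\<lambda>w. (cmod (x (rev w)))\<^sup>2) summable_on UNIV"
    by (subst summable_on_reindex_bij_betw[of rev UNIV UNIV "\<lambda>w. (cmod (x w))\<^sup>2"]) auto
qed

text \<open>\<open>right_creation \<xi> x = x \<otimes> \<xi>\<close>\<close>

definition right_creation :: "complex^'n::finite \<Rightarrow> 'n fock \<Rightarrow> 'n fock" where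
  "right_creation \<xi> x = flip (creation \<xi> (flip x))"

lemma coord_right_creation:
  "coord (right_creation \<xi> x) [] = 0"
  "coord (right_creation \<xi> x) (w @ [i]) = \<xi> $ i * coord x w"
  "coord (right_creation \<xi> x) [i] = \<xi> $ i * coord x []"
  "coord (right_creation \<xi> x) (k # w @ [i]) = \<xi> $ i * coord x (k # w)"
  by (simp_all add: right_creation_def flip.rep_eq creation.rep_eq)

lemma fock_eqI:
  assumes "coord x [] = coord y []" "\<And>w i. coord x (w @ [i]) = coord y (w @ [i])"
  shows "x = y"
proof (rule ell2_eqI)
  fix w show "coord x w = coord y w" by (cases w rule: rev_cases) (auto simp: assms)
qed

lemma right_creation_linear:
  "right_creation \<xi> (x + y) = right_creation \<xi> x + right_creation \<xi> y"
  "right_creation \<xi> (a *\<^sub>C x) = a *\<^sub>C right_creation \<xi> x"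
  by (rule fock_eqI; simp add: coord_simps coord_right_creation algebra_simps)+

lemma right_creation_creation:
  "right_creation \<xi> (creation \<eta> x) = creation \<eta> (right_creation \<xi> x)"
proof (rule fock_eqI)
  show "coord (right_creation \<xi> (creation \<eta> x)) (w @ [i]) =
      coord (creation \<eta> (right_creation \<xi> x)) (w @ [i])" for w i
    by (cases w) (simp_all add: coord_right_creation creation.rep_eq)
qed (simp add: coord_right_creation creation.rep_eq)

text \<open>The operators act on opposite ends of a word and interfere only on the vacuum: there
  \<open>\<xi>\<close> is the only letter, and contracting it leaves
  \<open>cdot \<eta> \<xi>\<close>, which the assumption makes 0.\<close>

lemma right_creation_left_contraction:
  assumes "cdot \<eta> \<xi> = 0"
  shows "right_creation \<xi> (left_contraction \<eta> x) = left_contraction \<eta> (right_creation \<xi> x)"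
proof (rule fock_eqI)
  have "coord (left_contraction \<eta> (right_creation \<xi> x)) [] = cdot \<eta> \<xi> * coord x []"
    by (simp add: left_contraction.rep_eq coord_right_creation cdot_def sum_distrib_right mult.assoc)
  with assms show "coord (right_creation \<xi> (left_contraction \<eta> x)) [] =
      coord (left_contraction \<eta> (right_creation \<xi> x)) []"
    by (simp add: coord_right_creation)
  show "coord (right_creation \<xi> (left_contraction \<eta> x)) (w @ [i]) =
      coord (left_contraction \<eta> (right_creation \<xi> x)) (w @ [i])" for w i
    by (simp add: coord_right_creation left_contraction.rep_eq sum_distrib_left ac_simps)
qed

section \<open>The vacuum and the grading by word length\<close>

lift_definition vacuum :: "'n fock" is "\<lambda>w. if w = [] then 1 else 0"
proof -
  have "(\<lambda>w :: 'n list. (cmod (if w = [] then 1 else 0))\<^sup>2) summable_on {[]}" by simp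
  then show "(\<lambda>w :: 'n list. (cmod (if w = [] then 1 else 0))\<^sup>2) summable_on UNIV"
    by (rule summable_on_cong_neutral[THEN iffD1, rotated 3]) auto
qed

lemma left_contraction_vacuum: "left_contraction \<xi> vacuum = 0"
  by (rule ell2_eqI) (simp add: left_contraction.rep_eq vacuum.rep_eq coord_simps)

lemma right_creation_vacuum: "right_creation \<xi> vacuum = creation \<xi> vacuum"
proof (rule fock_eqI)
  show "coord (right_creation \<xi> vacuum) (w @ [i]) = coord (creation \<xi> vacuum) (w @ [i])" for w i
    by (cases w) (auto simp: coord_right_creation creation.rep_eq vacuum.rep_eq)
qed (simp add: coord_right_creation creation.rep_eq)

lemma cinner_vacuum: "cinner vacuum vacuum = 1"
proof -
  have "((\<lambda>w :: 'n list. cnj (coord vacuum w) * coord vacuum w) has_sum 1) {[]}"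
    by (rule has_sum_finiteI) (auto simp: vacuum.rep_eq)
  then have "((\<lambda>w :: 'n list. cnj (coord vacuum w) * coord vacuum w) has_sum 1) UNIV"
    by (rule has_sum_cong_neutral[THEN iffD1, rotated 3]) (auto simp: vacuum.rep_eq)
  then show ?thesis unfolding cinner_def by (rule infsumI)
qed

lift_definition degree_part :: "nat \<Rightarrow> 'n fock \<Rightarrow> 'n fock" is
  "\<lambda>n x w. if length w = n then x w else 0"
proof -
  fix n and x :: "'n list \<Rightarrow> complex"
  assume "(\<lambda>w. (cmod (x w))\<^sup>2) summable_on UNIV"
  then show "(\<lambda>w. (cmod (if length w = n then x w else 0))\<^sup>2) summable_on UNIV"
    by (rule summable_on_comparison_test) auto
qed

lemma degree_part_linear:
  "degree_part n (x + y) = degree_part n x + degree_part n y"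
  "degree_part n (a *\<^sub>C x) = a *\<^sub>C degree_part n x"
  by (rule ell2_eqI; simp add: degree_part.rep_eq coord_simps)+

lemma degree_part_vacuum: "degree_part n vacuum = (if n = 0 then vacuum else 0)"
  by (rule ell2_eqI) (auto simp: degree_part.rep_eq vacuum.rep_eq coord_simps)

lemma degree_part_right_creation:
  "degree_part 0 (right_creation \<xi> x) = 0"
  "degree_part (Suc n) (right_creation \<xi> x) = right_creation \<xi> (degree_part n x)"
  by (rule fock_eqI; simp add: degree_part.rep_eq coord_right_creation coord_simps)+

text \<open>A finite set \<open>F\<close> of words carries all but \<open>(e/2)\<^sup>2\<close> of
  the squared norm. Beyond the longest word of \<open>F\<close>, a homogeneous part lives on words
  outside \<open>F\<close>.\<close>

lemma degree_part_tendsto_0: "(\<lambda>n. degree_part n x) \<longlonglongrightarrow> 0" for x :: "'n::finite fock"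
proof (rule metric_LIMSEQ_I)
  fix e :: real assume e: "e > 0"
  let ?g = "\<lambda>w. (cmod (coord x w))\<^sup>2"
  from infsum_finite_approximation[OF coord_summable, of "(e/2)\<^sup>2" x]
  obtain F where F: "finite F" "dist (sum ?g F) (infsum ?g UNIV) \<le> (e/2)\<^sup>2" using e by auto
  have "norm (degree_part n x) < e" if n: "n > Max (insert 0 (length ` F))" for n
  proof -
    have "norm (degree_part n x) \<le> e / 2"
    proof (rule norm_ell2_le)
      fix G :: "'n list set" assume G: "finite G"
      define G' where "G' = {w \<in> G. length w = n}"
      have disj: "F \<inter> G' = {}"
        using n F(1) by (auto simp: G'_def)
      have "(\<Sum>w\<in>G. (cmod (coord (degree_part n x) w))\<^sup>2) = sum ?g G'"
        unfolding G'_def by (rule sum.mono_neutral_cong_right) (use G in \<open>auto simp: degree_part.rep_eq\<close>)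
      also have "\<dots> = sum ?g (F \<union> G') - sum ?g F"
        using sum.union_disjoint[of F G' ?g] F(1) G disj by (simp add: G'_def)
      also have "\<dots> \<le> (e/2)\<^sup>2"
      proof -
        have "sum ?g (F \<union> G') \<le> infsum ?g UNIV"
          by (rule finite_sum_le_infsum) (simp_all add: coord_summable F G G'_def)
        then show ?thesis using F(2) by (simp add: dist_real_def abs_le_iff)
      qed
      finally show "(\<Sum>w\<in>G. (cmod (coord (degree_part n x) w))\<^sup>2) \<le> (e/2)\<^sup>2" .
    qed (use e in simp)
    then show ?thesis using e by simp
  qed
  then show "\<exists>N. \<forall>n\<ge>N. dist (degree_part n x) 0 < e"
    by (intro exI[of _ "Suc (Max (insert 0 (length ` F)))"]) (auto simp: Suc_le_eq)
qed

section \<open>A noncommutative Fibonacci recursion\<close>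

text \<open>\<open>fib_op B C n\<close> is the part of degree \<open>n\<close> of \<open>(1 - B - C)\<^sup>-\<^sup>1\<close>, where \<open>B\<close> has degree 1 and
  \<open>C\<close> has degree 2.\<close>

fun fib_op :: "('a \<Rightarrow> 'a) \<Rightarrow> ('a \<Rightarrow> 'a) \<Rightarrow> nat \<Rightarrow> 'a \<Rightarrow> 'a::plus" where
  "fib_op B C 0 x = x"
| "fib_op B C (Suc 0) x = B x"
| "fib_op B C (Suc (Suc n)) x = B (fib_op B C (Suc n) x) + C (fib_op B C n x)"

text \<open>\<open>fib_op B C n\<close> is the sum of all products of \<open>B\<close> and
  \<open>C\<close> of total degree \<open>n\<close>. The definition splits off the leftmost factor,
  this identity the rightmost one.\<close>

lemma fib_op_commute:
  fixes B C :: "'a::ab_group_add \<Rightarrow> 'a"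
  assumes "\<And>x y. B (x + y) = B x + B y" "\<And>x y. C (x + y) = C x + C y"
  shows "fib_op B C (Suc (Suc n)) x = fib_op B C (Suc n) (B x) + fib_op B C n (C x)"
proof (induction n rule: less_induct)
  case (less n)
  consider "n = 0" | "n = 1" | m where "n = Suc (Suc m)"
    by (metis One_nat_def not0_implies_Suc)
  then show ?case
  proof cases
    case 3
    have "fib_op B C (Suc (Suc n)) x = B (fib_op B C (Suc n) x) + C (fib_op B C n x)" by simp
    also have "fib_op B C (Suc n) x = fib_op B C n (B x) + fib_op B C (Suc m) (C x)"
      using less[of "Suc m"] 3 by simp
    also have "fib_op B C n x = fib_op B C (Suc m) (B x) + fib_op B C m (C x)"
      using less[of m] 3 by simp
    finally show ?thesis using 3 assms by (simp add: algebra_simps)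
  qed (simp_all add: assms algebra_simps)
qed

lemma bounded_clinear_fib_op:
  assumes "bounded_clinear B" "bounded_clinear C"
  shows "bounded_clinear (fib_op B C n)"
proof (induction n rule: induct_nat_012)
  case 0
  then show ?case by (simp add: bounded_clinear_ident)
next
  case 1
  then show ?case using assms by (simp add: bounded_clinear_ident)
next
  case (ge2 n)
  then show ?case
    using bounded_clinear_add[OF bounded_clinear_comp[OF assms(1) ge2(2)] bounded_clinear_comp[OF assms(2) ge2(1)]]
    by simp
qed

text \<open>The partial sums of \<open>\<Sum>n. fib_op B C n\<close> invert \<open>1 - B - C\<close> up to an error that tends to 0.\<close>

lemma invertible_op_fib:
  assumes B: "bounded_clinear B" and C: "bounded_clinear C"
    and s: "\<And>n x. norm (fib_op B C n x) \<le> s n * norm x" "s \<longlonglongrightarrow> 0"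
  shows "invertible_op (\<lambda>x. x - (B x + C x))"
proof -
  note linB = bounded_clinear_imp[OF B] and linC = bounded_clinear_imp[OF C]
  define Y where "Y = fib_op B C"
  define P where "P N x = (\<Sum>n\<le>N. Y n x)" for N x
  have Y: "bounded_clinear (Y n)" for n
    unfolding Y_def by (rule bounded_clinear_fib_op[OF B C])
  note linY = bounded_clinear_imp[OF Y]
  have P: "bounded_clinear (P N)" for N
    unfolding P_def by (intro bounded_clinear_sum Y)
  note linP = bounded_clinear_imp[OF P]
  have YS: "Y (Suc (Suc n)) x = Y (Suc n) (B x) + Y n (C x)" for n x
    unfolding Y_def by (rule fib_op_commute) (simp_all add: linB linC)
  \<comment> \<open>Telescoping: everything of degree 1 to \<open>N + 1\<close> cancels. What spills
    over is \<open>Y (N+2)\<close> in degree \<open>N + 2\<close> and \<open>C Y (N+1)\<close> in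
    degree \<open>N + 3\<close>. On the other side the spill is \<open>Y (N+1) C\<close>.\<close>
  have right: "P (Suc N) x - (B (P (Suc N) x) + C (P (Suc N) x))
      = x - (Y (Suc (Suc N)) x + C (Y (Suc N) x))" for N x
  proof (induction N)
    case 0
    then show ?case by (simp add: P_def Y_def linB linC algebra_simps)
  next
    case (Suc N)
    have "P (Suc (Suc N)) x = P (Suc N) x + Y (Suc (Suc N)) x" by (simp add: P_def)
    moreover have "Y (Suc (Suc (Suc N))) x = B (Y (Suc (Suc N)) x) + C (Y (Suc N) x)"
      by (simp add: Y_def)
    ultimately show ?case using Suc by (simp add: linB linC algebra_simps del: fib_op.simps)
  qed
  have left: "P (Suc N) (x - (B x + C x)) = x - (Y (Suc (Suc N)) x + Y (Suc N) (C x))" for N x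
  proof (induction N)
    case 0
    then show ?case by (simp add: P_def YS linY) (simp add: Y_def algebra_simps linB linC)
  next
    case (Suc N)
    have "P (Suc (Suc N)) y = P (Suc N) y + Y (Suc (Suc N)) y" for y by (simp add: P_def)
    then show ?case using Suc YS[of "Suc N" x] by (simp add: linY algebra_simps)
  qed
  obtain K where K: "0 < K" "\<And>x. norm (C x) \<le> K * norm x"
    using bounded_clinear_bound[OF C] by blast
  \<comment> \<open>Absolute values appear since \<open>s\<close> is not assumed
    nonnegative.\<close>
  have "(\<lambda>N. \<bar>s (Suc (Suc N))\<bar> + K * \<bar>s (Suc N)\<bar>) \<longlonglongrightarrow> \<bar>0\<bar> + K * \<bar>0\<bar>"
    by (intro tendsto_intros LIMSEQ_Suc s)
  then have "\<forall>\<^sub>F N in sequentially. \<bar>s (Suc (Suc N))\<bar> + K * \<bar>s (Suc N)\<bar> < 1"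
    by (rule order_tendstoD) simp
  then obtain N where N: "\<bar>s (Suc (Suc N))\<bar> + K * \<bar>s (Suc N)\<bar> < 1"
    by (auto simp: eventually_sequentially)
  have sY: "norm (Y n x) \<le> \<bar>s n\<bar> * norm x" for n x
    unfolding Y_def using s(1)[of n x] by (meson abs_ge_self mult_right_mono norm_ge_zero order_trans)
  have 1: "norm (Y (Suc (Suc N)) x + C (Y (Suc N) x))
      \<le> (\<bar>s (Suc (Suc N))\<bar> + K * \<bar>s (Suc N)\<bar>) * norm x" for x
  proof -
    have "norm (C (Y (Suc N) x)) \<le> K * (\<bar>s (Suc N)\<bar> * norm x)"
      by (rule order_trans[OF K(2)]) (intro mult_left_mono sY, use K in simp)
    then show ?thesis
      using sY[of "Suc (Suc N)" x] norm_triangle_ineq[of "Y (Suc (Suc N)) x" "C (Y (Suc N) x)"]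
      by (simp add: algebra_simps)
  qed
  have 2: "norm (Y (Suc (Suc N)) x + Y (Suc N) (C x))
      \<le> (\<bar>s (Suc (Suc N))\<bar> + K * \<bar>s (Suc N)\<bar>) * norm x" for x
  proof -
    have "norm (Y (Suc N) (C x)) \<le> \<bar>s (Suc N)\<bar> * (K * norm x)"
      by (rule order_trans[OF sY]) (intro mult_left_mono K, simp)
    then show ?thesis
      using sY[of "Suc (Suc N)" x] norm_triangle_ineq[of "Y (Suc (Suc N)) x" "Y (Suc N) (C x)"]
      by (simp add: algebra_simps)
  qed
  show ?thesis
  proof (rule invertible_op_two_sided[OF P[of "Suc N"]])
    show "invertible_op (\<lambda>x. P (Suc N) (x - (B x + C x)))"
      unfolding left
      by (rule invertible_op_id_minus[OF _ N 2]) (rule bounded_clinear_add[OF Y bounded_clinear_comp[OF Y C]])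
    show "invertible_op (\<lambda>x. P (Suc N) x - (B (P (Suc N) x) + C (P (Suc N) x)))"
      unfolding right
      by (rule invertible_op_id_minus[OF _ N 1]) (rule bounded_clinear_add[OF Y bounded_clinear_comp[OF C Y]])
  qed
qed

section \<open>The orbit of the matrix \<open>Q\<close>\<close>

lemma exhaust_6: "x = 1 \<or> x = 2 \<or> x = 3 \<or> x = 4 \<or> x = 5 \<or> x = 6" for x :: 6
proof (induct x)
  case (of_int z)
  then have "0 \<le> z" "z < 6" by simp_all
  then have "z = 0 \<or> z = 1 \<or> z = 2 \<or> z = 3 \<or> z = 4 \<or> z = 5" by presburger
  then show ?case by auto
qed

lemma UNIV_6: "UNIV = {1, 2, 3, 4, 5, 6 :: 6}"
  using exhaust_6 by auto

lemma sum_6: "sum f (UNIV :: 6 set) = f 1 + f 2 + f 3 + f 4 + f 5 + f 6"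
  unfolding UNIV_6 by (simp add: ac_simps)

lemma vector_6:
  fixes a b c d e f :: "'a::zero"
  shows "(vector [a, b, c, d, e, f] :: 'a^6) $ 1 = a" "(vector [a, b, c, d, e, f] :: 'a^6) $ 2 = b"
    "(vector [a, b, c, d, e, f] :: 'a^6) $ 3 = c" "(vector [a, b, c, d, e, f] :: 'a^6) $ 4 = d"
    "(vector [a, b, c, d, e, f] :: 'a^6) $ 5 = e" "(vector [a, b, c, d, e, f] :: 'a^6) $ 6 = f"
  unfolding vector_def by simp_all

definition Q_orbit :: "complex^2^2 \<Rightarrow> complex^2 \<Rightarrow> nat \<Rightarrow> complex^6" where
  "Q_orbit A b n = matrix_pow (Q_matrix A b) n *v axis 1 1"

lemma Q_orbit_Suc: "Q_orbit A b (Suc n) = Q_matrix A b *v Q_orbit A b n"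
  by (simp add: Q_orbit_def matrix_pow_def matrix_vector_mul_assoc)

lemma Q_orbit_0: "Q_orbit A b 0 = axis 1 1"
  by (simp add: Q_orbit_def matrix_pow_def)

lemma Q_orbit_rec:
  fixes A :: "complex^2^2" and b :: "complex^2"
  defines "x \<equiv> Q_orbit A b"
  shows "x (Suc n) $ 1 = (\<Sum>i\<in>UNIV. cnj (b $ i) * b $ i) * x n $ 1
      + (\<Sum>i\<in>UNIV. \<Sum>j\<in>UNIV. cnj (A $ i $ j) * A $ i $ j) * x n $ 2
      + (\<Sum>i\<in>UNIV. cnj (b $ i) * (A $ i $ 1 * x n $ 3 + A $ i $ 2 * x n $ 4))
      + (\<Sum>i\<in>UNIV. b $ i * (cnj (A $ i $ 1) * x n $ 5 + cnj (A $ i $ 2) * x n $ 6))"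
    and "x (Suc n) $ 2 = x n $ 1"
    and "x (Suc n) $ 3 = cnj (b $ 1) * x n $ 1 + cnj (A $ 1 $ 1) * x n $ 5 + cnj (A $ 1 $ 2) * x n $ 6"
    and "x (Suc n) $ 4 = cnj (b $ 2) * x n $ 1 + cnj (A $ 2 $ 1) * x n $ 5 + cnj (A $ 2 $ 2) * x n $ 6"
    and "x (Suc n) $ 5 = b $ 1 * x n $ 1 + A $ 1 $ 1 * x n $ 3 + A $ 1 $ 2 * x n $ 4"
    and "x (Suc n) $ 6 = b $ 2 * x n $ 1 + A $ 2 $ 1 * x n $ 3 + A $ 2 $ 2 * x n $ 4"
  unfolding x_def Q_orbit_Suc
  by (simp_all add: Q_matrix_def Let_def matrix_vector_mult_def sum_6 vector_6 cdot_def trace_def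
      matrix_matrix_mult_def ctranspose_def map_matrix_def transpose_def cnj_vec_def
      vector_matrix_mult_def sum_2 algebra_simps)

lemma Q_orbit_0_nth: "Q_orbit A b 0 $ k = (if k = 1 then 1 else 0)"
  by (simp add: Q_orbit_0 axis_def)

text \<open>Entrywise conjugation combined with exchanging the two blocks of size 2 maps
  \<open>Q\<close> to itself and fixes its starting vector, hence fixes the whole orbit. The inner
  products to be computed below are thereby halved.\<close>

lemma Q_orbit_cnj:
  "cnj (Q_orbit A b n $ 1) = Q_orbit A b n $ 1" "cnj (Q_orbit A b n $ 2) = Q_orbit A b n $ 2"
  "Q_orbit A b n $ 3 = cnj (Q_orbit A b n $ 5)" "Q_orbit A b n $ 4 = cnj (Q_orbit A b n $ 6)"
proof (induction n)
  case (Suc n)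
  then show "cnj (Q_orbit A b (Suc n) $ 1) = Q_orbit A b (Suc n) $ 1"
    "cnj (Q_orbit A b (Suc n) $ 2) = Q_orbit A b (Suc n) $ 2"
    "Q_orbit A b (Suc n) $ 3 = cnj (Q_orbit A b (Suc n) $ 5)"
    "Q_orbit A b (Suc n) $ 4 = cnj (Q_orbit A b (Suc n) $ 6)"
    by (simp_all add: Q_orbit_rec sum_2 algebra_simps)
qed (simp_all add: Q_orbit_0_nth)

section \<open>Homogeneous parts of the inverse and their inner products\<close>

definition linear_part :: "complex^2 \<Rightarrow> (2 \<Rightarrow> 'a ell2 \<Rightarrow> 'a ell2) \<Rightarrow> 'a ell2 \<Rightarrow> 'a ell2" where
  "linear_part b L x = (\<Sum>i\<in>UNIV. b $ i *\<^sub>C L i x)"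

text \<open>Two families are allowed so that the mixed part \<open>K\<close> is an instance as
  well.\<close>

definition quadratic_part ::
  "complex^2^2 \<Rightarrow> (2 \<Rightarrow> 'a ell2 \<Rightarrow> 'a ell2) \<Rightarrow> (2 \<Rightarrow> 'a ell2 \<Rightarrow> 'a ell2) \<Rightarrow> 'a ell2 \<Rightarrow> 'a ell2" where
  "quadratic_part A L M x = (\<Sum>i\<in>UNIV. \<Sum>j\<in>UNIV. A $ i $ j *\<^sub>C L i (M j x))"

lemma quadratic_poly_parts: "quadratic_poly A b c x = quadratic_part A c c x + linear_part b c x"
  by (simp add: quadratic_poly_def quadratic_part_def linear_part_def)

lemma bounded_clinear_linear_part:
  "(\<And>i. bounded_clinear (L i)) \<Longrightarrow> bounded_clinear (linear_part b L)"
  unfolding linear_part_def by (intro bounded_clinear_sum bounded_clinear_scaleC)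

lemma bounded_clinear_quadratic_part:
  assumes "\<And>i. bounded_clinear (L i)" "\<And>i. bounded_clinear (M i)"
  shows "bounded_clinear (quadratic_part A L M)"
  unfolding quadratic_part_def
  by (intro bounded_clinear_sum bounded_clinear_scaleC bounded_clinear_comp[OF assms])

text \<open>The \<open>L i\<close> are isometries with orthogonal ranges. Writing
  \<open>Y (n+2)\<close> as \<open>L 1 (h 1) + L 2 (h 2)\<close> reduces its inner products to those
  of \<open>h 1\<close> and \<open>h 2\<close>, hence to those of \<open>Y (n+1)\<close>,
  \<open>L 1 (Y n)\<close> and \<open>L 2 (Y n)\<close>. The coefficients that arise are the entries
  of \<open>Q\<close>.\<close>

lemma cinner_fib_op:
  fixes L :: "2 \<Rightarrow> 'a ell2 \<Rightarrow> 'a ell2" and A :: "complex^2^2" and b :: "complex^2"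
  assumes L: "\<And>i j x y. cinner (L i x) (L j y) = (if i = j then cinner x y else 0)"
    and lin: "\<And>i. bounded_clinear (L i)"
  defines "Y \<equiv> fib_op (linear_part b L) (quadratic_part A L L)"
  shows "cinner (Y n x) (Y n y) = Q_orbit A b n $ 1 * cinner x y"
    and "cinner (L 1 (Y n x)) (Y (Suc n) y) = Q_orbit A b (Suc n) $ 5 * cinner x y"
    and "cinner (L 2 (Y n x)) (Y (Suc n) y) = Q_orbit A b (Suc n) $ 6 * cinner x y"
proof -
  note linL = bounded_clinear_imp[OF lin]
  \<comment> \<open>Two consecutive degrees are carried along, since the recursion has depth two;
    entry 2 of the orbit remembers the earlier one.\<close>
  have "(\<forall>x y. cinner (Y n x) (Y n y) = Q_orbit A b n $ 1 * cinner x y) \<and>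
    (\<forall>x y. cinner (Y (Suc n) x) (Y (Suc n) y) = Q_orbit A b (Suc n) $ 1 * cinner x y) \<and>
    (\<forall>x y. cinner (L 1 (Y n x)) (Y (Suc n) y) = Q_orbit A b (Suc n) $ 5 * cinner x y) \<and>
    (\<forall>x y. cinner (L 2 (Y n x)) (Y (Suc n) y) = Q_orbit A b (Suc n) $ 6 * cinner x y)"
  proof (induction n)
    case 0
    show ?case
      by (simp add: Y_def linear_part_def sum_2 cinner_simps L Q_orbit_rec Q_orbit_0_nth algebra_simps)
  next
    case (Suc n)
    from Suc have IH: "cinner (Y n x) (Y n y) = Q_orbit A b n $ 1 * cinner x y"
      "cinner (Y (Suc n) x) (Y (Suc n) y) = Q_orbit A b (Suc n) $ 1 * cinner x y"
      "cinner (L 1 (Y n x)) (Y (Suc n) y) = Q_orbit A b (Suc n) $ 5 * cinner x y"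
      "cinner (L 2 (Y n x)) (Y (Suc n) y) = Q_orbit A b (Suc n) $ 6 * cinner x y" for x y
      by blast+
    have IH': "cinner (Y (Suc n) x) (L 1 (Y n y)) = Q_orbit A b (Suc n) $ 3 * cinner x y"
      "cinner (Y (Suc n) x) (L 2 (Y n y)) = Q_orbit A b (Suc n) $ 4 * cinner x y" for x y
      by (subst (1 2) cinner_commute; simp add: IH Q_orbit_cnj)+
    define h where "h i x = b $ i *\<^sub>C Y (Suc n) x + A $ i $ 1 *\<^sub>C L 1 (Y n x) + A $ i $ 2 *\<^sub>C L 2 (Y n x)"
      for i x
    have Y: "Y (Suc (Suc n)) x = L 1 (h 1 x) + L 2 (h 2 x)" for x
      by (simp add: Y_def h_def linear_part_def quadratic_part_def sum_2 linL algebra_simps)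
    have 1: "cinner (L 1 (Y (Suc n) x)) (Y (Suc (Suc n)) y) = Q_orbit A b (Suc (Suc n)) $ 5 * cinner x y"
      "cinner (L 2 (Y (Suc n) x)) (Y (Suc (Suc n)) y) = Q_orbit A b (Suc (Suc n)) $ 6 * cinner x y" for x y
      unfolding Y Q_orbit_rec[of A b "Suc n"]
      by (simp_all add: cinner_simps L h_def IH IH' algebra_simps)
    have 2: "cinner (Y (Suc (Suc n)) x) (Y (Suc (Suc n)) y) = Q_orbit A b (Suc (Suc n)) $ 1 * cinner x y" for x y
      unfolding Y Q_orbit_rec[of A b "Suc n"] Q_orbit_rec(2)[of A b n]
      by (simp add: cinner_simps L h_def IH IH' sum_2 algebra_simps)
    show ?case using 1 2 Suc by blast
  qed
  then show "cinner (Y n x) (Y n y) = Q_orbit A b n $ 1 * cinner x y"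
    "cinner (L 1 (Y n x)) (Y (Suc n) y) = Q_orbit A b (Suc n) $ 5 * cinner x y"
    "cinner (L 2 (Y n x)) (Y (Suc n) y) = Q_orbit A b (Suc n) $ 6 * cinner x y"
    by blast+
qed

text \<open>The adjoints of the powers of \<open>l\<^sup>*(g\<^sub>i)\<close> reverse the order of multiplication. Expanding the recursion
  from the right instead of from the left gives the same orbit.\<close>

lemma cinner_fib_op_mirror:
  fixes M :: "2 \<Rightarrow> 'a ell2 \<Rightarrow> 'a ell2" and A :: "complex^2^2" and b :: "complex^2"
  assumes M: "\<And>i j x y. cinner (M i x) (M j y) = (if i = j then cinner x y else 0)"
    and lin: "\<And>i. bounded_clinear (M i)"
  defines "Y \<equiv> fib_op (linear_part (cnj_vec b) M) (quadratic_part (ctranspose A) M M)"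
  shows "cinner (Y n x) (Y n y) = Q_orbit A b n $ 1 * cinner x y"
proof -
  note linM = bounded_clinear_imp[OF lin]
  have B: "bounded_clinear (linear_part (cnj_vec b) M)"
    by (rule bounded_clinear_linear_part[OF lin])
  have C: "bounded_clinear (quadratic_part (ctranspose A) M M)"
    by (rule bounded_clinear_quadratic_part[OF lin lin])
  have linY: "Y n (x + y) = Y n x + Y n y" "Y n (a *\<^sub>C x) = a *\<^sub>C Y n x" for n x y a
    using bounded_clinear_imp[OF bounded_clinear_fib_op[OF B C]] by (simp_all add: Y_def)
  \<comment> \<open>With the rightmost factor split off, \<open>Y n (M i x)\<close> takes over the
    role of \<open>L i (Y n x)\<close>. As the coefficients are conjugated, entries 3 and 4 now
    occur where 5 and 6 did.\<close>
  have Y: "Y (Suc (Suc n)) x = cnj (b $ 1) *\<^sub>C Y (Suc n) (M 1 x) + cnj (b $ 2) *\<^sub>C Y (Suc n) (M 2 x)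
    + (cnj (A $ 1 $ 1) *\<^sub>C Y n (M 1 (M 1 x)) + cnj (A $ 2 $ 1) *\<^sub>C Y n (M 1 (M 2 x))
    + cnj (A $ 1 $ 2) *\<^sub>C Y n (M 2 (M 1 x)) + cnj (A $ 2 $ 2) *\<^sub>C Y n (M 2 (M 2 x)))" for n x
  proof -
    have "Y (Suc (Suc n)) x = Y (Suc n) (linear_part (cnj_vec b) M x)
        + Y n (quadratic_part (ctranspose A) M M x)"
      unfolding Y_def
      by (rule fib_op_commute) (simp_all add: bounded_clinear_imp[OF B] bounded_clinear_imp[OF C])
    then show ?thesis
      by (simp add: linear_part_def quadratic_part_def sum_2 linY cnj_vec_def ctranspose_def
          transpose_def map_matrix_def algebra_simps)
  qed
  have "(\<forall>x y. cinner (Y n x) (Y n y) = Q_orbit A b n $ 1 * cinner x y) \<and>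
    (\<forall>x y. cinner (Y (Suc n) x) (Y (Suc n) y) = Q_orbit A b (Suc n) $ 1 * cinner x y) \<and>
    (\<forall>x y. cinner (Y n (M 1 x)) (Y (Suc n) y) = Q_orbit A b (Suc n) $ 3 * cinner x y) \<and>
    (\<forall>x y. cinner (Y n (M 2 x)) (Y (Suc n) y) = Q_orbit A b (Suc n) $ 4 * cinner x y)"
  proof (induction n)
    case 0
    show ?case
      by (simp add: Y_def linear_part_def sum_2 cinner_simps M Q_orbit_rec Q_orbit_0_nth
          cnj_vec_def algebra_simps)
  next
    case (Suc n)
    from Suc have IH: "cinner (Y n x) (Y n y) = Q_orbit A b n $ 1 * cinner x y"
      "cinner (Y (Suc n) x) (Y (Suc n) y) = Q_orbit A b (Suc n) $ 1 * cinner x y"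
      "cinner (Y n (M 1 x)) (Y (Suc n) y) = Q_orbit A b (Suc n) $ 3 * cinner x y"
      "cinner (Y n (M 2 x)) (Y (Suc n) y) = Q_orbit A b (Suc n) $ 4 * cinner x y" for x y
      by blast+
    have IH': "cinner (Y (Suc n) x) (Y n (M 1 y)) = Q_orbit A b (Suc n) $ 5 * cinner x y"
      "cinner (Y (Suc n) x) (Y n (M 2 y)) = Q_orbit A b (Suc n) $ 6 * cinner x y" for x y
      by (subst (1 2) cinner_commute; simp add: IH Q_orbit_cnj)+
    have 1: "cinner (Y (Suc n) (M 1 x)) (Y (Suc (Suc n)) y) = Q_orbit A b (Suc (Suc n)) $ 3 * cinner x y"
      "cinner (Y (Suc n) (M 2 x)) (Y (Suc (Suc n)) y) = Q_orbit A b (Suc (Suc n)) $ 4 * cinner x y" for x y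
      unfolding Y Q_orbit_rec[of A b "Suc n"]
      by (simp_all add: cinner_simps M IH IH' algebra_simps)
    have 2: "cinner (Y (Suc (Suc n)) x) (Y (Suc (Suc n)) y) = Q_orbit A b (Suc (Suc n)) $ 1 * cinner x y" for x y
      unfolding Y Q_orbit_rec[of A b "Suc n"] Q_orbit_rec(2)[of A b n]
      by (simp add: cinner_simps M IH IH' sum_2 algebra_simps)
    show ?case using 1 2 Suc by blast
  qed
  then show ?thesis by blast
qed

section \<open>Spectra of quadratic polynomials\<close>

text \<open>The \<open>c i\<close> below are creation by \<open>f i\<close> plus annihilation by
  \<open>g i\<close>. The given circular variables are brought to this form in
  \<open>circular_decomposition\<close>.\<close>

locale free_circular =
  fixes f g :: "2 \<Rightarrow> complex^'n::finite"
  assumes ff: "cdot (f i) (f j) = (if i = j then 1 else 0)"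
    and gg: "cdot (g i) (g j) = (if i = j then 1 else 0)"
    and gf: "cdot (g i) (f j) = 0"
begin

definition L :: "2 \<Rightarrow> 'n fock \<Rightarrow> 'n fock" where "L i = creation (f i)"
definition M :: "2 \<Rightarrow> 'n fock \<Rightarrow> 'n fock" where "M i = creation (g i)"
definition G :: "2 \<Rightarrow> 'n fock \<Rightarrow> 'n fock" where "G i = left_contraction (g i)"
definition c :: "2 \<Rightarrow> 'n fock \<Rightarrow> 'n fock" where "c i x = L i x + G i x"

lemma bounded: "bounded_clinear (L i)" "bounded_clinear (M i)" "bounded_clinear (G i)" "bounded_clinear (c i)"
proof -
  show "bounded_clinear (L i)" "bounded_clinear (M i)" "bounded_clinear (G i)"
    unfolding L_def M_def G_def by (rule bounded_clinear_creation bounded_clinear_left_contraction)+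
  then show "bounded_clinear (c i)" unfolding c_def by (intro bounded_clinear_add)
qed

lemmas lin = bounded_clinear_imp(2-)[OF bounded(1)] bounded_clinear_imp(2-)[OF bounded(2)]
  bounded_clinear_imp(2-)[OF bounded(3)] bounded_clinear_imp(2-)[OF bounded(4)]

lemma GL: "G i (L j x) = 0"
  by (simp add: G_def L_def left_contraction_creation gf scaleC_simps)

lemma cinner_L: "cinner (L i x) (L j y) = (if i = j then cinner x y else 0)"
  and cinner_M: "cinner (M i x) (M j y) = (if i = j then cinner x y else 0)"
  by (simp_all add: L_def M_def cinner_creation ff gg)

lemma cinner_M_G: "cinner (M i x) y = cinner x (G i y)"
  unfolding M_def G_def by (subst (1 2) cinner_commute) (simp add: cinner_left_contraction)

text \<open>By \<open>GL\<close> every product in which some \<open>G i\<close> stands directly left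
  of some \<open>L j\<close> vanishes. So no cross terms arise in the triple product, and
  \<open>F\<close> itself is just \<open>F\<^sub>L + K + F\<^sub>G\<close>.\<close>

lemma quadratic_poly_factorization:
  "x - quadratic_poly A b c x =
    (let y = x - (linear_part b L x + quadratic_part A L L x);
         z = y - quadratic_part A L G y
     in z - (linear_part b G z + quadratic_part A G G z))"
  unfolding Let_def quadratic_poly_parts
  by (simp add: linear_part_def quadratic_part_def sum_2 c_def lin GL scaleC_simps algebra_simps)

context
  fixes A :: "complex^2^2" and b :: "complex^2"
begin

section \<open>Sufficiency: decay of the orbit makes all three factors invertible\<close>

lemma invertible_op_L:
  assumes "Q_orbit A b \<longlonglongrightarrow> 0"
  shows "invertible_op (\<lambda>x. x - (linear_part b L x + quadratic_part A L L x))"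
proof (rule invertible_op_fib)
  show "norm (fib_op (linear_part b L) (quadratic_part A L L) n x)
      \<le> sqrt (cmod (Q_orbit A b n $ 1)) * norm x" for n x
    by (rule eq_refl, rule norm_eq_of_cinner, rule cinner_fib_op[OF cinner_L bounded(1)])
  have "(\<lambda>n. sqrt (cmod (Q_orbit A b n $ 1))) \<longlonglongrightarrow> sqrt (cmod ((0 :: complex^6) $ 1))"
    by (intro tendsto_intros assms)
  then show "(\<lambda>n. sqrt (cmod (Q_orbit A b n $ 1))) \<longlonglongrightarrow> 0" by simp
qed (intro bounded_clinear_linear_part bounded_clinear_quadratic_part bounded)+

text \<open>It is the adjoint of each homogeneous part that scales norms, by
  \<open>cinner_fib_op_mirror\<close>; the bound passes back through
  \<open>norm_adjoint_le\<close>.\<close>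

lemma invertible_op_G:
  assumes "Q_orbit A b \<longlonglongrightarrow> 0"
  shows "invertible_op (\<lambda>x. x - (linear_part b G x + quadratic_part A G G x))"
proof -
  define B where "B = linear_part b G"
  define C where "C = quadratic_part A G G"
  define B' where "B' = linear_part (cnj_vec b) M"
  define C' where "C' = quadratic_part (ctranspose A) M M"
  have B: "bounded_clinear B" and C: "bounded_clinear C"
    unfolding B_def C_def by (intro bounded_clinear_linear_part bounded_clinear_quadratic_part bounded)+
  have B': "cinner (B' x) y = cinner x (B y)" for x y
    by (simp add: B_def B'_def linear_part_def sum_2 cinner_simps cinner_M_G cnj_vec_def)
  have C': "cinner (C' x) y = cinner x (C y)" for x y
    by (simp add: C_def C'_def quadratic_part_def sum_2 cinner_simps cinner_M_G ctranspose_def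
        map_matrix_def transpose_def)
  \<comment> \<open>Adjoints reverse products, so splitting on the left for \<open>B'\<close>,
    \<open>C'\<close> meets splitting on the right for \<open>B\<close>, \<open>C\<close>.\<close>
  have adj: "cinner (fib_op B' C' n x) y = cinner x (fib_op B C n y)" for n x y
  proof (induction n arbitrary: x y rule: induct_nat_012)
    case (ge2 n)
    have "fib_op B C (Suc (Suc n)) y = fib_op B C (Suc n) (B y) + fib_op B C n (C y)"
      by (rule fib_op_commute) (simp_all add: bounded_clinear_imp[OF B] bounded_clinear_imp[OF C])
    then show ?case using ge2 by (simp add: cinner_simps B' C')
  qed (simp_all add: B')
  have "invertible_op (\<lambda>x. x - (B x + C x))"
  proof (rule invertible_op_fib[OF B C])
    have "norm (fib_op B' C' n x) \<le> sqrt (cmod (Q_orbit A b n $ 1)) * norm x" for n x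
      unfolding B'_def C'_def
      by (rule eq_refl, rule norm_eq_of_cinner, rule cinner_fib_op_mirror[OF cinner_M bounded(2)])
    then show "norm (fib_op B C n x) \<le> sqrt (cmod (Q_orbit A b n $ 1)) * norm x" for n x
      by (rule norm_adjoint_le[OF adj])
    have "(\<lambda>n. sqrt (cmod (Q_orbit A b n $ 1))) \<longlonglongrightarrow> sqrt (cmod ((0 :: complex^6) $ 1))"
      by (intro tendsto_intros assms)
    then show "(\<lambda>n. sqrt (cmod (Q_orbit A b n $ 1))) \<longlonglongrightarrow> 0" by simp
  qed
  then show ?thesis by (simp add: B_def C_def)
qed

text \<open>The mixed part squares to 0 by \<open>GL\<close>, so the Neumann series stops at
  \<open>1 + K\<close>.\<close>

lemma invertible_op_LG: "invertible_op (\<lambda>x. x - quadratic_part A L G x)"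
  unfolding invertible_op_def
proof (intro exI conjI)
  show "bounded_clinear (\<lambda>x. x + quadratic_part A L G x)"
    by (intro bounded_clinear_add bounded_clinear_ident bounded_clinear_quadratic_part bounded)
qed (simp_all add: fun_eq_iff quadratic_part_def sum_2 lin GL scaleC_simps algebra_simps)

lemma invertible_op_if:
  assumes "Q_orbit A b \<longlonglongrightarrow> 0"
  shows "invertible_op (\<lambda>x. x - quadratic_poly A b c x)"
  using invertible_op_comp[OF invertible_op_G[OF assms]
      invertible_op_comp[OF invertible_op_LG invertible_op_L[OF assms]]]
  unfolding quadratic_poly_factorization Let_def .

section \<open>Necessity: the resolvent applied to the vacuum\<close>

lemma resolvent_vacuum:
  fixes z :: complex
  assumes R: "bounded_clinear R" "R \<circ> (\<lambda>x. z *\<^sub>C x - quadratic_poly A b c x) = id"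
    "(\<lambda>x. z *\<^sub>C x - quadratic_poly A b c x) \<circ> R = id"
  defines "r \<equiv> \<lambda>i. right_creation (f i)" and "y \<equiv> R vacuum"
  shows "z *\<^sub>C y = vacuum + (linear_part b r y + (\<Sum>i\<in>UNIV. \<Sum>j\<in>UNIV. A $ i $ j *\<^sub>C r j (r i y)))"
proof -
  define T where "T x = z *\<^sub>C x - quadratic_poly A b c x" for x
  have RT: "R (T x) = x" "T (R x) = x" for x
    using R by (auto simp: T_def fun_eq_iff)
  have r_lin: "r i (x + y) = r i x + r i y" "r i (a *\<^sub>C x) = a *\<^sub>C r i x" for i x y a
    by (simp_all add: r_def right_creation_linear)
  have r_diff: "r i (x - y) = r i x - r i y" for i x y
    using r_lin(1)[of i "x - y" y] by (simp add: algebra_simps)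
  have rc: "r i (c j x) = c j (r i x)" for i j x
    by (simp add: r_def c_def L_def G_def right_creation_linear right_creation_creation
        right_creation_left_contraction gf)
  have rT: "r i (T x) = T (r i x)" for i x
    by (simp add: T_def quadratic_poly_def sum_2 r_lin r_diff rc)
  have rR: "R (r i x) = r i (R x)" for i x
    using RT(1)[of "r i (R x)"] rT[of i "R x"] RT(2)[of x] by simp
  have cv: "c i vacuum = r i vacuum" for i
    by (simp add: c_def L_def G_def r_def left_contraction_vacuum right_creation_vacuum)
  \<comment> \<open>The order reverses: \<open>r j\<close> is moved out to the left of
    \<open>c i\<close> before \<open>c i\<close> meets the vacuum.\<close>
  have ccv: "c i (c j vacuum) = r j (r i vacuum)" for i j
    by (simp add: cv flip: rc)
  note linR = bounded_clinear_imp[OF R(1)]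
  have "vacuum = R (T vacuum)" by (simp add: RT)
  also have "\<dots> = z *\<^sub>C y - (linear_part b r y + (\<Sum>i\<in>UNIV. \<Sum>j\<in>UNIV. A $ i $ j *\<^sub>C r j (r i y)))"
    by (simp add: T_def quadratic_poly_def linear_part_def sum_2 ccv linR rR y_def)
      (simp add: cv linR rR algebra_simps)
  finally show ?thesis by (simp add: algebra_simps)
qed

text \<open>Right creations have no vacuum component, so for \<open>z = 0\<close> comparing vacuum
  coefficients in \<open>resolvent_vacuum\<close> gives 0 = 1.\<close>

lemma zero_not_invertible: "\<not> invertible_op (\<lambda>x. 0 *\<^sub>C x - quadratic_poly A b c x)"
proof
  assume "invertible_op (\<lambda>x. 0 *\<^sub>C x - quadratic_poly A b c x)"
  then obtain R where R: "bounded_clinear R" "R \<circ> (\<lambda>x. 0 *\<^sub>C x - quadratic_poly A b c x) = id"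
    "(\<lambda>x. 0 *\<^sub>C x - quadratic_poly A b c x) \<circ> R = id"
    unfolding invertible_op_def by blast
  show False
    using arg_cong[OF resolvent_vacuum[OF R], of "\<lambda>x. coord x []"]
    by (simp add: coord_simps coord_right_creation linear_part_def sum_2 vacuum.rep_eq)
qed

text \<open>Degree by degree, the equation for \<open>y\<close> becomes a recursion that starts at
  the vacuum and determines all homogeneous parts. These tend to 0 because \<open>y\<close> is
  square-summable.\<close>

lemma fib_op_vacuum_tendsto_0:
  assumes "invertible_op (\<lambda>x. x - quadratic_poly A b c x)"
  shows "(\<lambda>n. fib_op (linear_part b L) (quadratic_part A L L) n vacuum) \<longlonglongrightarrow> 0"
proof -
  from assms obtain R where R: "bounded_clinear R" "R \<circ> (\<lambda>x. 1 *\<^sub>C x - quadratic_poly A b c x) = id"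
    "(\<lambda>x. 1 *\<^sub>C x - quadratic_poly A b c x) \<circ> R = id"
    unfolding invertible_op_def by (auto simp: scaleC_simps)
  define r where "r i = right_creation (f i)" for i
  define B where "B = linear_part b L"
  define C where "C = quadratic_part A L L"
  define B' where "B' = linear_part b r"
  define C' where "C' x = (\<Sum>i\<in>UNIV. \<Sum>j\<in>UNIV. A $ i $ j *\<^sub>C r j (r i x))" for x
  define y where "y = R vacuum"
  have y: "y = vacuum + (B' y + C' y)"
    using resolvent_vacuum[OF R] by (simp add: B'_def C'_def y_def r_def[abs_def] scaleC_simps)
  have r_lin: "r i (x + y) = r i x + r i y" "r i (a *\<^sub>C x) = a *\<^sub>C r i x" for i x y a
    by (simp_all add: r_def right_creation_linear)
  have rL: "r i (L j x) = L j (r i x)" for i j x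
    by (simp add: r_def L_def right_creation_creation)
  have B: "bounded_clinear B" and C: "bounded_clinear C"
    unfolding B_def C_def by (intro bounded_clinear_linear_part bounded_clinear_quadratic_part bounded)+
  define Y where "Y = fib_op B C"
  note linY = bounded_clinear_imp[OF bounded_clinear_fib_op[OF B C], folded Y_def]
  have rY: "r i (Y n x) = Y n (r i x)" for i n x
  proof (induction n arbitrary: x rule: induct_nat_012)
    case (ge2 n)
    then show ?case
      by (simp add: Y_def B_def C_def linear_part_def quadratic_part_def sum_2 r_lin rL)
  qed (simp_all add: Y_def B_def linear_part_def sum_2 r_lin rL)
  have "r i vacuum = L i vacuum" for i by (simp add: r_def L_def right_creation_vacuum)
  \<comment> \<open>On vectors \<open>Y n vacuum\<close>, right creation amounts to inserting a
    factor at the right end, next to the vacuum. The recursion for \<open>y\<close> thus matches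
    \<open>fib_op_commute\<close>.\<close>
  then have B'_vac: "B' (Y n vacuum) = Y n (B vacuum)" and C'_vac: "C' (Y n vacuum) = Y n (C vacuum)" for n
    by (simp_all add: B_def B'_def C_def C'_def linear_part_def quadratic_part_def sum_2 linY rY rL)
  have deg_B: "degree_part 0 (B' x) = 0" "degree_part (Suc n) (B' x) = B' (degree_part n x)" for n x
    by (simp_all add: B'_def linear_part_def sum_2 degree_part_linear r_def degree_part_right_creation scaleC_simps)
  have deg_C: "degree_part 0 (C' x) = 0" "degree_part (Suc 0) (C' x) = 0"
    "degree_part (Suc (Suc n)) (C' x) = C' (degree_part n x)" for n x
  proof -
    have r0: "right_creation \<xi> 0 = 0" for \<xi> :: "complex^'n"
      using right_creation_linear(2)[of \<xi> 0 0] by (simp add: scaleC_simps)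
    show "degree_part 0 (C' x) = 0" "degree_part (Suc 0) (C' x) = 0"
    "degree_part (Suc (Suc n)) (C' x) = C' (degree_part n x)"
      by (simp_all add: C'_def sum_2 degree_part_linear r_def degree_part_right_creation scaleC_simps r0)
  qed
  have "degree_part n y = Y n vacuum" for n
  proof (induction n rule: induct_nat_012)
    case 0
    then show ?case
      by (subst y) (simp add: degree_part_linear degree_part_vacuum deg_B deg_C Y_def)
  next
    case 1
    have "degree_part (Suc 0) y = B' (degree_part 0 y)"
      by (subst y) (simp add: degree_part_linear degree_part_vacuum deg_B deg_C)
    also have "degree_part 0 y = Y 0 vacuum"
      by (subst y) (simp add: degree_part_linear degree_part_vacuum deg_B deg_C Y_def)
    finally show ?case by (simp add: B'_vac) (simp add: Y_def)
  next
    case (ge2 n)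
    have "degree_part (Suc (Suc n)) y = B' (degree_part (Suc n) y) + C' (degree_part n y)"
      by (subst y) (simp add: degree_part_linear degree_part_vacuum deg_B deg_C)
    also have "\<dots> = Y (Suc n) (B vacuum) + Y n (C vacuum)"
      by (simp add: ge2 B'_vac C'_vac)
    also have "\<dots> = Y (Suc (Suc n)) vacuum"
      unfolding Y_def
      by (rule fib_op_commute[symmetric]) (simp_all add: bounded_clinear_imp[OF B] bounded_clinear_imp[OF C])
    finally show ?case .
  qed
  then show ?thesis using degree_part_tendsto_0[of y] by (simp add: Y_def B_def C_def)
qed

text \<open>On the unit vector \<open>vacuum\<close> the entries 1, 5 and 6 are inner products
  bounded by norms of \<open>v\<close>. Entry 2 is a delayed entry 1, and entries 3 and 4 are
  conjugates of 5 and 6.\<close>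

lemma Q_orbit_tendsto_0:
  assumes "invertible_op (\<lambda>x. x - quadratic_poly A b c x)"
  shows "Q_orbit A b \<longlonglongrightarrow> 0"
proof -
  define v where "v n = fib_op (linear_part b L) (quadratic_part A L L) n vacuum" for n
  have "v \<longlonglongrightarrow> 0" using fib_op_vacuum_tendsto_0[OF assms] by (simp add: v_def[abs_def])
  then have n0: "(\<lambda>n. norm (v n)) \<longlonglongrightarrow> 0" by (rule tendsto_norm_zero)
  note Q = cinner_fib_op[OF cinner_L bounded(1), of b A _ vacuum vacuum, folded v_def,
      unfolded cinner_vacuum mult_1_right]
  have norm_L: "norm (L i x) = norm x" for i x
    using norm_eq_of_cinner[of "L i" x 1] by (simp add: cinner_L)
  have lim: "(\<lambda>n. norm (v n) * norm (v n)) \<longlonglongrightarrow> 0"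
    "(\<lambda>n. norm (v n) * norm (v (Suc n))) \<longlonglongrightarrow> 0"
    using tendsto_mult[OF n0 n0] tendsto_mult[OF n0 LIMSEQ_Suc[OF n0]] by simp_all
  have "cmod (Q_orbit A b n $ 1) \<le> norm (v n) * norm (v n)" for n
    using cmod_cinner_le[of "v n" "v n"] by (simp only: Q(1))
  then have 1: "(\<lambda>n. Q_orbit A b n $ 1) \<longlonglongrightarrow> 0"
    by (intro Lim_null_comparison[OF always_eventually lim(1)] allI)
  then have 2: "(\<lambda>n. Q_orbit A b (Suc n) $ 2) \<longlonglongrightarrow> 0" by (simp add: Q_orbit_rec)
  have "cmod (Q_orbit A b (Suc n) $ 5) \<le> norm (v n) * norm (v (Suc n))"
    "cmod (Q_orbit A b (Suc n) $ 6) \<le> norm (v n) * norm (v (Suc n))" for n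
    using cmod_cinner_le[of "L 1 (v n)" "v (Suc n)"] cmod_cinner_le[of "L 2 (v n)" "v (Suc n)"]
    by (simp_all only: Q(2,3) norm_L)
  then have u: "(\<lambda>n. Q_orbit A b (Suc n) $ 5) \<longlonglongrightarrow> 0" "(\<lambda>n. Q_orbit A b (Suc n) $ 6) \<longlonglongrightarrow> 0"
    by (intro Lim_null_comparison[OF always_eventually lim(2)] allI; blast)+
  have "(\<lambda>n. cnj (Q_orbit A b (Suc n) $ 5)) \<longlonglongrightarrow> cnj 0" "(\<lambda>n. cnj (Q_orbit A b (Suc n) $ 6)) \<longlonglongrightarrow> cnj 0"
    by (intro tendsto_intros u)+
  then have w: "(\<lambda>n. Q_orbit A b (Suc n) $ 3) \<longlonglongrightarrow> 0" "(\<lambda>n. Q_orbit A b (Suc n) $ 4) \<longlonglongrightarrow> 0"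
    by (simp_all add: Q_orbit_cnj)
  have "(\<lambda>n. Q_orbit A b (Suc n) $ k) \<longlonglongrightarrow> 0" for k
    using exhaust_6[of k] LIMSEQ_Suc[OF 1] 2 u w by auto
  then have "(\<lambda>n. Q_orbit A b (Suc n)) \<longlonglongrightarrow> 0"
    by (intro vec_tendstoI) simp
  then show ?thesis by (rule LIMSEQ_imp_Suc)
qed

end

end

section \<open>From the given circular variables to the two orthonormal families\<close>

lemma cdot_linear:
  "cdot (u + v) w = cdot u w + cdot v w" "cdot w (u + v) = cdot w u + cdot w v"
  "cdot (a *s u) w = cnj a * cdot u w" "cdot w (a *s u) = a * cdot w u"
  by (simp_all add: cdot_def algebra_simps sum.distrib sum_distrib_left)

text \<open>Annihilation is conjugate-linear in its vector, so the factor \<open>\<i>\<close> in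
  front of the second semicircular enters \<open>f i\<close> with a plus sign and \<open>g i\<close>
  with a minus sign.\<close>

lemma circular_decomposition:
  assumes "orthonormal_basis e"
  obtains f g where "free_circular f g" "circular e = free_circular.c f g"
proof -
  have e: "cdot (e i) (e j) = (if i = j then 1 else 0)" for i j
    using assms by (simp add: orthonormal_basis_def)
  define s where "s = 1 / complex_of_real (sqrt 2)"
  define p where "p = s * \<i>"
  \<comment> \<open>Naming the conjugate of \<open>p\<close> keeps conjugation within
    \<open>s\<close>, \<open>p\<close>, \<open>m\<close>, so that orthonormality reduces to the
    products in \<open>spm\<close>.\<close>
  define m where "m = - p"
  have s_sq: "s * s = 1 / 2" by (simp add: s_def flip: of_real_mult)
  have cnj: "cnj s = s" "cnj p = m" "cnj m = p" by (simp_all add: s_def p_def m_def)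
  have spm: "s * s = 1 / 2" "p * m = 1 / 2" "m * p = 1 / 2" "p * p = - 1 / 2"
    using s_sq by (simp_all add: p_def m_def algebra_simps)
  define \<iota> where "\<iota> k = (if k = 1 then 1 else 2 :: 4)" for k :: 2
  define f where "f i = s *s e (\<iota> i) + p *s e (2 + \<iota> i)" for i
  define g where "g i = s *s e (\<iota> i) + m *s e (2 + \<iota> i)" for i
  have \<iota>: "\<iota> i = \<iota> j \<longleftrightarrow> i = j" "2 + \<iota> i = 2 + \<iota> j \<longleftrightarrow> i = j" "\<iota> i \<noteq> 2 + \<iota> j" "2 + \<iota> i \<noteq> \<iota> j" for i j
    using exhaust_2[of i] exhaust_2[of j] by (auto simp: \<iota>_def)
  interpret free_circular f g
    by standard (simp_all add: f_def g_def cdot_linear e \<iota> cnj spm)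
  have "circular e i x = c i x" for i x
    by (simp add: circular_def semicircular_def annihilation_eq c_def L_def G_def f_def g_def
        creation_add_vec left_contraction_add_vec cnj p_def scaleC_simps algebra_simps Let_def
        flip: s_def \<iota>_def)
  then have "circular e = c" by (intro ext)
  then show thesis by (rule that[OF free_circular_axioms])
qed

lemma quadratic_poly_scale:
  "quadratic_poly (map_matrix (\<lambda>a. t * a) A) (t *s b) c x = t *\<^sub>C quadratic_poly A b c x"
  by (simp add: quadratic_poly_def sum_2 map_matrix_def scaleC_simps)

theorem theorem1p4:
  fixes e :: "4 \<Rightarrow> complex^4" and A :: "complex^2^2" and b :: "complex^2"
  assumes "orthonormal_basis e"
  shows "spectral_set (quadratic_poly A b (circular e)) =
    {z. z = 0 \<or> (z \<noteq> 0 \<and>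
      \<not> ((\<lambda>n. matrix_pow (Q_matrix (map_matrix (\<lambda>a. inverse z * a) A) (inverse z *s b)) n
              *v axis 1 1) \<longlonglongrightarrow> 0))}"
proof -
  obtain f g where "free_circular f g" and c: "circular e = free_circular.c f g"
    using circular_decomposition[OF assms] .
  then interpret free_circular f g by simp
  have "z \<in> spectral_set (quadratic_poly A b c) \<longleftrightarrow>
    \<not> Q_orbit (map_matrix (\<lambda>a. inverse z * a) A) (inverse z *s b) \<longlonglongrightarrow> 0" if "z \<noteq> 0" for z
  proof -
    let ?A = "map_matrix (\<lambda>a. inverse z * a) A" and ?b = "inverse z *s b"
    \<comment> \<open>Dividing by \<open>z\<close> moves the spectral parameter into the
      coefficients and reduces to the point 1.\<close>
    have "z *\<^sub>C x - quadratic_poly A b c x = z *\<^sub>C (x - quadratic_poly ?A ?b c x)" for x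
      using that by (simp add: quadratic_poly_scale scaleC_simps)
    then have "z \<in> spectral_set (quadratic_poly A b c)
        \<longleftrightarrow> \<not> invertible_op (\<lambda>x. x - quadratic_poly ?A ?b c x)"
      by (simp add: spectral_set_iff invertible_op_scaleC that)
    then show ?thesis using invertible_op_if Q_orbit_tendsto_0 by blast
  qed
  moreover have "0 \<in> spectral_set (quadratic_poly A b c)"
    by (simp only: spectral_set_iff zero_not_invertible not_False_eq_True)
  ultimately show ?thesis unfolding c Q_orbit_def by auto
qed

end
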